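(* There exists a randomized algorithm with the following property. Given a positive integer $k$ and value-oracle access to a non-negative submodular function $f\colon 2^{\mathcal{N}}\to\mathbb{R}$ on a ground set $\mathcal{N}$ of size $n$, the algorithm outputs a set $S\subseteq\mathcal{N}$ with $|S|\le k$ such that $\mathbb{E}[f(S)]\ge 0.385\cdot f(\mathrm{OPT})$, where $\mathrm{OPT}\in\arg\max\{f(T): T\subseteq\mathcal{N},\,|T|\le k\}$, and the algorithm makes $O(n+k^2)$ queries to the value oracle of $f$.
   Context: A set function $f\colon 2^{\mathcal{N}}\to\mathbb{R}$ is submodular if $f(A\cup\{s\})-f(A)\ge f(B\cup\{s\})-f(B)$ for all $A\subseteq B\subseteq\mathcal{N}$ and $s\in\mathcal{N}\setminus B$; it is non-negative if $f(A)\ge 0$ for all $A$. A value-oracle query returns $f(A)$ for a queried set $A$. The function need not be monotone. *)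

theory Defs
  imports "HOL-Probability.Probability"
begin

definition submodular_on :: "'a set \<Rightarrow> ('a set \<Rightarrow> real) \<Rightarrow> bool" where
  "submodular_on N f \<longleftrightarrow>
     (\<forall>A B s. A \<subseteq> B \<and> B \<subseteq> N \<and> s \<in> N - B \<longrightarrow>
        f (A \<union> {s}) - f A \<ge> f (B \<union> {s}) - f B)"

definition nonneg_on :: "'a set \<Rightarrow> ('a set \<Rightarrow> real) \<Rightarrow> bool" where
  "nonneg_on N f \<longleftrightarrow> (\<forall>A. A \<subseteq> N \<longrightarrow> f A \<ge> 0)"

text \<open>Deterministic value-oracle algorithms as (adaptive) query trees:
  either output a set, or query the oracle on a set and continue depending on the answer.\<close>
datatype 'a qtree = Output "'a set" | Query "'a set" "real \<Rightarrow> 'a qtree"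

primrec run :: "'a qtree \<Rightarrow> ('a set \<Rightarrow> real) \<Rightarrow> 'a set" where
  "run (Output S) f = S"
| "run (Query Q g) f = run (g (f Q)) f"

primrec num_queries :: "'a qtree \<Rightarrow> ('a set \<Rightarrow> real) \<Rightarrow> nat" where
  "num_queries (Output S) f = 0"
| "num_queries (Query Q g) f = Suc (num_queries (g (f Q)) f)"

definition opt_value :: "'a set \<Rightarrow> nat \<Rightarrow> ('a set \<Rightarrow> real) \<Rightarrow> real" where
  "opt_value N k f = Max (f ` {T. T \<subseteq> N \<and> card T \<le> k})"

end

theory Submission
  imports Defs
begin

text \<open>Local search produces a random feasible set \<open>Z\<close> that is, up to a small error and in expectation,
  locally optimal: \<open>f Z\<close> dominates \<open>f (Z \<inter> Q)\<close> and the average of \<open>f (Z \<inter> Q)\<close> and \<open>f (Z \<union> Q)\<close>, where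
  \<open>Q\<close> is an optimal solution. Random greedy is then run for \<open>k\<close> steps, the first \<open>h\<close> of them barred
  from \<open>Z\<close>; its value is at least a combination of \<open>f Q\<close>, \<open>- f (Z \<inter> Q)\<close> and \<open>- f (Z \<union> Q)\<close>. Outputting
  \<open>Z\<close> with a suitable probability cancels the two negative terms, and for \<open>h \<approx> 2k/5\<close>
  (\<open>h = 0\<close> if \<open>k \<le> 11\<close>) the coefficient left in front of \<open>f Q\<close> is at least \<open>0.3852\<close>, up to small errors.

  Each step needs an element that is good in expectation but equal to any given element with
  probability at most \<open>1/k\<close>. It is a uniformly random one among the best \<open>b\<close> of about \<open>2 a n / k\<close> random
  draws, with constants \<open>a\<close> slightly smaller than \<open>b\<close>: then all drawn members of \<open>Q\<close> are likely to be
  no more than \<open>b\<close>. This costs \<open>O(n/k + 1)\<close> queries per step, and the choice of an element to remove in local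
  search costs \<open>k\<close> more; there are \<open>O(k)\<close> steps.\<close>

section \<open>Expectations of finitely supported distributions and sampling\<close>

abbreviation expect :: "'a pmf \<Rightarrow> ('a \<Rightarrow> real) \<Rightarrow> real" where
  "expect p h \<equiv> measure_pmf.expectation p h"

lemma expect_bind:
  assumes "finite (set_pmf p)" "\<And>x. x \<in> set_pmf p \<Longrightarrow> finite (set_pmf (q x))"
  shows "expect (p \<bind> q) h = expect p (\<lambda>x. expect (q x) h)"
proof -
  have "expect (p \<bind> q) h = (\<Sum>a\<in>set_pmf p. pmf p a *\<^sub>R expect (q a) h)"
    using assms by (intro pmf_expectation_bind) auto
  also have "\<dots> = expect p (\<lambda>x. expect (q x) h)"
    using assms(1) by (subst integral_measure_pmf_real[of "set_pmf p"]) (auto simp: mult.commute)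
  finally show ?thesis .
qed

lemma expect_mono:
  assumes "finite (set_pmf p)" "\<And>x. x \<in> set_pmf p \<Longrightarrow> g x \<le> h x"
  shows "expect p g \<le> expect p h"
  using assms by (intro integral_mono_AE integrable_measure_pmf_finite) (auto simp: AE_measure_pmf_iff)

lemma expect_add:
  assumes "finite (set_pmf p)"
  shows "expect p (\<lambda>x. g x + h x) = expect p g + expect p h"
  using assms by (simp add: integrable_measure_pmf_finite)

lemma expect_diff:
  assumes "finite (set_pmf p)"
  shows "expect p (\<lambda>x. g x - h x) = expect p g - expect p h"
  using assms by (simp add: integrable_measure_pmf_finite)

lemma expect_cong:
  assumes "\<And>x. x \<in> set_pmf p \<Longrightarrow> g x = h x"
  shows "expect p g = expect p h"
  using assms by (intro integral_cong_AE) (auto simp: AE_measure_pmf_iff)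

lemma finite_set_replicate_pmf:
  "finite (set_pmf p) \<Longrightarrow> finite (set_pmf (replicate_pmf n p))"
  by (induction n) auto

lemma expect_replicate_Suc:
  assumes "finite (set_pmf p)"
  shows "expect (replicate_pmf (Suc n) p) h
       = expect p (\<lambda>x. expect (replicate_pmf n p) (\<lambda>xs. h (x # xs)))"
  using assms finite_set_replicate_pmf[OF assms, of n] by (simp add: expect_bind)

lemma expect_sum_list_replicate:
  assumes "finite (set_pmf p)"
  shows "expect (replicate_pmf n p) (\<lambda>xs. sum_list (map h xs)) = real n * expect p h"
proof (induction n)
  case (Suc n)
  show ?case
    using assms finite_set_replicate_pmf[OF assms, of n] Suc
    by (simp add: expect_replicate_Suc expect_add algebra_simps del: replicate_pmf.simps)
qed auto

text \<open>The tail of the binomial distribution enters only through Chernoff's exponential bound,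
  which obeys the same recursion in \<open>(r, d)\<close> as the distribution function itself.\<close>

lemma expect_first_hits:
  fixes H :: "'x \<Rightarrow> real" and O' :: "'x set"
  assumes fin: "finite (set_pmf p)" and H: "\<And>x. H x \<ge> 0" and lam: "lam \<ge> 1"
  defines "pr \<equiv> expect p (indicator O')"
  defines "m \<equiv> expect p (\<lambda>x. indicator O' x * H x)"
  shows "expect (replicate_pmf r p) (\<lambda>xs. sum_list (map H (take d (filter (\<lambda>x. x \<in> O') xs))))
       \<ge> real r * m * (1 - (1 + pr * (lam - 1)) ^ r / lam ^ d)"
proof (induction r arbitrary: d)
  case (Suc r)
  let ?S = "\<lambda>d xs. sum_list (map H (take d (filter (\<lambda>x. x \<in> O') xs)))"
  let ?th = "1 + pr * (lam - 1)"
  have m0: "m \<ge> 0" unfolding m_def using H by (intro Bochner_Integration.integral_nonneg) auto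
  have pr0: "pr \<ge> 0" unfolding pr_def by (intro Bochner_Integration.integral_nonneg) auto
  have pr1: "expect p (\<lambda>x. 1 - indicator O' x) = 1 - pr"
    using fin by (simp add: expect_diff pr_def)
  have th1: "?th \<ge> 1" using pr0 lam by simp
  show ?case
  proof (cases d)
    case 0
    have "?th ^ Suc r \<ge> 1" using th1 by (rule one_le_power)
    then have "real (Suc r) * m * (1 - ?th ^ Suc r / lam ^ d) \<le> 0"
      using 0 m0 by (intro mult_nonneg_nonpos) auto
    then show ?thesis using 0 by simp
  next
    case (Suc d')
    let ?q = "\<lambda>d. 1 - ?th ^ r / lam ^ d"
    let ?E = "\<lambda>d. expect (replicate_pmf r p) (?S d)"
    have fr: "finite (set_pmf (replicate_pmf r p))" using fin by (rule finite_set_replicate_pmf)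
    \<comment> \<open>Condition on the first draw: a hit is collected and leaves \<open>d'\<close>
      places, a miss leaves all \<open>d\<close>.\<close>
    have "expect (replicate_pmf (Suc r) p) (?S d)
        = expect p (\<lambda>x. indicator O' x * H x + (indicator O' x * ?E d' + (1 - indicator O' x) * ?E d))"
      unfolding expect_replicate_Suc[OF fin]
      by (intro expect_cong) (auto simp: Suc expect_add[OF fr] indicator_def)
    also have "\<dots> = m + (pr * ?E d' + (1 - pr) * ?E d)"
      unfolding expect_add[OF fin] m_def pr1[symmetric]
      by (simp add: pr_def)
    finally have step: "expect (replicate_pmf (Suc r) p) (?S d) = m + (pr * ?E d' + (1 - pr) * ?E d)" .
    have lower: "m + (pr * ?E d' + (1 - pr) * ?E d) \<ge> m + (pr * (real r * m * ?q d') + (1 - pr) * (real r * m * ?q d))"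
    proof -
      have "pr \<le> 1" unfolding pr_def
        using expect_mono[OF fin, of "indicator O'" "\<lambda>_. 1"] by (simp add: indicator_le_1)
      then show ?thesis using pr0 Suc.IH by (intro add_left_mono add_mono mult_left_mono) auto
    qed
    have factor: "m + (pr * (real r * m * x) + (1 - pr) * (real r * m * y))
        = m + real r * m * (pr * x + (1 - pr) * y)" for x y
      by (simp add: algebra_simps)
    \<comment> \<open>Since \<open>lam ^ d = lam * lam ^ d'\<close>, the mixture multiplies the tail
      bound by \<open>pr * lam + (1 - pr)\<close>, which is \<open>?th\<close>.\<close>
    have "pr * ?q d' + (1 - pr) * ?q d = 1 - ?th ^ Suc r / lam ^ d"
      using lam by (simp add: Suc field_simps)
    then have "m + (pr * (real r * m * ?q d') + (1 - pr) * (real r * m * ?q d))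
        = m + real r * m * (1 - ?th ^ Suc r / lam ^ d)"
      using factor[of "?q d'" "?q d"] by simp
    moreover have "m * (1 - ?th ^ Suc r / lam ^ d) \<le> m * 1"
      using m0 th1 lam by (intro mult_left_mono) auto
    ultimately have "m + (pr * ?E d' + (1 - pr) * ?E d)
        \<ge> m * (1 - ?th ^ Suc r / lam ^ d) + real r * m * (1 - ?th ^ Suc r / lam ^ d)"
      using lower by linarith
    moreover have "real (Suc r) * m * x = m * x + real r * m * x" for x
      by (simp add: algebra_simps)
    ultimately show ?thesis unfolding step by presburger
  qed
qed auto

section \<open>Selection among random samples\<close>

lemma sum_mset_le_sum_take:
  fixes G :: "'x \<Rightarrow> real"
  assumes "sorted_wrt (\<lambda>x y. G y \<le> G x) s" "Y \<subseteq># mset s" "size Y \<le> c" "\<And>x. G x \<ge> 0"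
  shows "sum_mset (image_mset G Y) \<le> sum_list (map G (take c s))"
  using assms(1-3)
proof (induction s arbitrary: Y c)
  case (Cons x s)
  show ?case
  proof (cases "Y = {#}")
    case True
    then show ?thesis using assms(4) by (auto intro!: sum_list_nonneg)
  next
    case False
    \<comment> \<open>If \<open>x\<close> lies in \<open>Y\<close>, it must be the element removed,
      since otherwise \<open>Y - {#y#}\<close> need not fit into the tail \<open>s\<close>. If not,
      any member of \<open>Y\<close> will do, as none exceeds \<open>x\<close> in
      \<open>G\<close>.\<close>
    define y where "y = (if x \<in># Y then x else (SOME y. y \<in># Y))"
    have y: "y \<in># Y" using False unfolding y_def by (metis multiset_nonemptyE someI_ex)
    have sub: "Y - {#y#} \<subseteq># mset s"
    proof (cases "x \<in># Y")
      case True
      then show ?thesis using Cons.prems(2) by (simp add: y_def subset_eq_diff_conv)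
    next
      case False
      then have "Y \<subseteq># mset s" using Cons.prems(2)
        by (metis diff_single_trivial mset.simps(2) subset_eq_diff_conv add_mset_add_single)
      then show ?thesis by (meson diff_subset_eq_self subset_mset.order_trans)
    qed
    have "y \<in> set (x # s)" using y Cons.prems(2) by (metis mset_subset_eqD set_mset_mset)
    then have yx: "G y \<le> G x" using Cons.prems(1) by auto
    obtain c' where c': "c = Suc c'" using Cons.prems(3) False by (cases c) auto
    have "size (Y - {#y#}) \<le> c'" using Cons.prems(3) y c' by (simp add: size_Diff_singleton)
    then have "sum_mset (image_mset G (Y - {#y#})) \<le> sum_list (map G (take c' s))"
      using Cons.IH sub Cons.prems(1) by auto
    moreover have "sum_mset (image_mset G Y) = G y + sum_mset (image_mset G (Y - {#y#}))"
      using y by (metis (no_types, lifting) image_mset_add_mset insert_DiffM sum_mset.add_mset)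
    ultimately show ?thesis using yx c' by simp
  qed
qed (use assms(4) in auto)

text \<open>The element of rank \<open>j\<close>, counted from \<open>0\<close> in decreasing order of \<open>w\<close>; unspecified unless \<open>j < length xs\<close>.\<close>

definition pick :: "('x \<Rightarrow> real) \<Rightarrow> 'x list \<times> nat \<Rightarrow> 'x" where
  "pick w = (\<lambda>(xs, j). sort_key (\<lambda>x. - w x) xs ! j)"

lemma pick_in_set: "j < length xs \<Longrightarrow> pick w (xs, j) \<in> set xs"
  unfolding pick_def by (metis case_prod_conv length_sort nth_mem set_sort)

lemma insort_key_eq:
  assumes "\<And>y. y \<in> insert x (set ys) \<Longrightarrow> f y = g y"
  shows "insort_key f x ys = insort_key g x ys"
  using assms by (induction ys) auto

lemma pick_cong:
  assumes "\<And>x. x \<in> set xs \<Longrightarrow> v x = w x"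
  shows "pick v (xs, j) = pick w (xs, j)"
proof -
  have "sort_key (\<lambda>x. - v x) xs = sort_key (\<lambda>x. - w x) xs"
    using assms
  proof (induction xs)
    case (Cons x xs)
    then have "insort_key (\<lambda>x. - v x) x (sort_key (\<lambda>x. - w x) xs)
             = insort_key (\<lambda>x. - w x) x (sort_key (\<lambda>x. - w x) xs)"
      by (intro insort_key_eq) auto
    with Cons show ?case by simp
  qed simp
  then show ?thesis by (simp add: pick_def)
qed

text \<open>\<open>None\<close> is a dummy. Drawing an index and reading it through an arbitrary
  enumeration of \<open>N\<close> gives the dummy its multiplicity and, if
  \<open>card N \<le> M\<close>, each element of \<open>N\<close> the probability
  \<open>1 / M\<close>.\<close>

definition draw_pmf :: "'a set \<Rightarrow> nat \<Rightarrow> 'a option pmf" where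
  "draw_pmf N M = map_pmf (\<lambda>i. if i < card N then Some ((SOME e. bij_betw e {..<card N} N) i) else None)
                    (pmf_of_set {..<M})"

lemma expect_draw_pmf:
  assumes "finite N" "card N \<le> M" "M > 0"
  shows "expect (draw_pmf N M) h
       = ((\<Sum>v\<in>N. h (Some v)) + real (M - card N) * h None) / real M"
proof -
  define e where "e = (SOME e. bij_betw e {..<card N} N)"
  have e: "bij_betw e {..<card N} N"
    unfolding e_def using ex_bij_betw_nat_finite[OF assms(1)]
    by (intro someI_ex[of "\<lambda>e. bij_betw e {..<card N} N"]) (auto simp: atLeast0LessThan)
  have M: "{..<M} = {..<card N} \<union> {card N..<M}" using assms(2) by auto
  have "expect (draw_pmf N M) h = (\<Sum>i<M. h (if i < card N then Some (e i) else None)) / real M"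
    unfolding draw_pmf_def e_def[symmetric] using assms(3)
    by (simp add: integral_pmf_of_set lessThan_empty_iff)
  also have "(\<Sum>i<M. h (if i < card N then Some (e i) else None))
           = (\<Sum>i<card N. h (Some (e i))) + (\<Sum>i=card N..<M. h None)"
    unfolding M by (subst sum.union_disjoint) auto
  also have "(\<Sum>i<card N. h (Some (e i))) = (\<Sum>v\<in>N. h (Some v))"
    using sum.reindex_bij_betw[OF e, of "\<lambda>v. h (Some v)"] .
  finally show ?thesis by simp
qed

lemma finite_draw_pmf: "M > 0 \<Longrightarrow> finite (set_pmf (draw_pmf N M))"
  unfolding draw_pmf_def by (simp add: lessThan_empty_iff)

text \<open>The \<open>a * blocks N k\<close> draws of a sample are uniform on \<open>N\<close> padded by copies of \<open>None\<close> to the size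
  \<open>k * blocks N k\<close>, so that on average \<open>a\<close> of them hit a given set of size \<open>k\<close>. The factor \<open>2\<close> guarantees at
  least \<open>b\<close> draws even if \<open>N\<close> is small.\<close>

definition blocks :: "'a set \<Rightarrow> nat \<Rightarrow> nat" where
  "blocks N k = 2 * (card N div k + 1)"

definition sample_pmf :: "'a set \<Rightarrow> nat \<Rightarrow> nat \<Rightarrow> nat \<Rightarrow> ('a option list \<times> nat) pmf" where
  "sample_pmf N k a b =
     pair_pmf (replicate_pmf (a * blocks N k) (draw_pmf N (k * blocks N k))) (pmf_of_set {..<b})"

lemma card_le_blocks: "k > 0 \<Longrightarrow> card N \<le> k * blocks N k"
proof -
  assume "k > 0"
  then have "card N < k * (card N div k + 1)"
    by (metis Suc_eq_plus1 dividend_less_times_div mult_Suc_right add.commute)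
  then show ?thesis unfolding blocks_def by simp
qed

lemma set_sample_pmf:
  assumes "k > 0" "b > 0"  "s \<in> set_pmf (sample_pmf N k a b)"
  shows "length (fst s) = a * blocks N k" "snd s < b"
  using assms by (auto simp: sample_pmf_def set_replicate_pmf lessThan_empty_iff)

lemma finite_sample_pmf:
  assumes "k > 0" "b > 0"
  shows "finite (set_pmf (sample_pmf N k a b))"
  using assms unfolding sample_pmf_def
  by (auto simp: lessThan_empty_iff blocks_def intro!: finite_set_replicate_pmf finite_draw_pmf)

text \<open>The uniform rank turns the picked element into an average over the best \<open>b\<close>
  draws; \<open>b \<le> 2 * a\<close> ensures that there are that many, so no unspecified entry is
  read.\<close>

lemma expect_sample_pmf:
  assumes "k > 0" "b > 0" "b \<le> 2 * a"
  shows "expect (sample_pmf N k a b) (\<lambda>s. h (pick w s))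
       = expect (replicate_pmf (a * blocks N k) (draw_pmf N (k * blocks N k)))
           (\<lambda>xs. sum_list (map h (take b (sort_key (\<lambda>x. - w x) xs)))) / real b"
proof -
  let ?R = "replicate_pmf (a * blocks N k) (draw_pmf N (k * blocks N k))"
  have M: "k * blocks N k > 0" using assms by (simp add: blocks_def)
  have fR: "finite (set_pmf ?R)"
    using M by (intro finite_set_replicate_pmf finite_draw_pmf)
  have "expect (sample_pmf N k a b) (\<lambda>s. h (pick w s))
      = expect ?R (\<lambda>xs. (\<Sum>j<b. h (sort_key (\<lambda>x. - w x) xs ! j)) / real b)"
    unfolding sample_pmf_def pair_pmf_def using assms(2) fR
    by (simp add: expect_bind integral_pmf_of_set lessThan_empty_iff pick_def)
  also have "\<dots> = expect ?R (\<lambda>xs. sum_list (map h (take b (sort_key (\<lambda>x. - w x) xs))) / real b)"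
  proof (intro expect_cong)
    fix xs assume "xs \<in> set_pmf ?R"
    then have "length xs = a * blocks N k" by (simp add: set_replicate_pmf)
    moreover have "a * 2 \<le> a * blocks N k" by (simp add: blocks_def)
    ultimately have "b \<le> length xs" using assms(3) by linarith
    then show "(\<Sum>j<b. h (sort_key (\<lambda>x. - w x) xs ! j)) / real b
      = sum_list (map h (take b (sort_key (\<lambda>x. - w x) xs))) / real b"
      by (auto simp: sum_list_sum_nth atLeast0LessThan min_def intro!: sum.cong)
  qed
  finally show ?thesis by simp
qed

text \<open>Upper bound on the probability of each element: it is at most \<open>1/k\<close>, weighted by a cost \<open>c\<close>.\<close>

lemma expect_pick_le:
  assumes "finite N" "k > 0" "b > 0" "a \<le> b" "b \<le> 2 * a"
    and "c None = 0" "\<And>x. c x \<ge> 0"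
  shows "expect (sample_pmf N k a b) (\<lambda>s. c (pick w s)) \<le> (\<Sum>v\<in>N. c (Some v)) / real k"
proof -
  let ?D = "draw_pmf N (k * blocks N k)"
  let ?R = "replicate_pmf (a * blocks N k) ?D"
  have bl: "blocks N k > 0" by (simp add: blocks_def)
  then have M: "k * blocks N k > 0" using assms by simp
  have fR: "finite (set_pmf ?R)" using M by (intro finite_set_replicate_pmf finite_draw_pmf)
  \<comment> \<open>The best \<open>b\<close> draws cost no more than all draws together; the
    resulting factor \<open>a / b\<close> is at most \<open>1\<close>.\<close>
  have "expect ?R (\<lambda>xs. sum_list (map c (take b (sort_key (\<lambda>x. - w x) xs))))
      \<le> expect ?R (\<lambda>xs. sum_list (map c xs))"
  proof (rule expect_mono[OF fR])
    fix xs
    let ?s = "sort_key (\<lambda>x. - w x) xs"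
    have "sum_list (map c (take b ?s)) \<le> sum_list (map c (take b ?s)) + sum_list (map c (drop b ?s))"
      using sum_list_nonneg[of "map c (drop b ?s)"] assms(7) by auto
    also have "\<dots> = sum_list (map c ?s)"
      by (metis append_take_drop_id map_append sum_list_append)
    also have "\<dots> = sum_list (map c xs)"
      unfolding sum_mset_sum_list[symmetric] mset_map by simp
    finally show "sum_list (map c (take b ?s)) \<le> sum_list (map c xs)" .
  qed
  also have "\<dots> = real (a * blocks N k) * ((\<Sum>v\<in>N. c (Some v)) / real (k * blocks N k))"
    unfolding expect_sum_list_replicate[OF finite_draw_pmf[OF M]]
      expect_draw_pmf[OF assms(1) card_le_blocks[OF assms(2)] M]
    by (simp add: assms(6))
  also have "\<dots> = real a * ((\<Sum>v\<in>N. c (Some v)) / real k)"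
    using bl by simp
  also have "\<dots> \<le> real b * ((\<Sum>v\<in>N. c (Some v)) / real k)"
    using assms by (intro mult_right_mono divide_nonneg_nonneg sum_nonneg) auto
  finally show ?thesis
    using assms by (simp add: expect_sample_pmf field_simps)
qed

text \<open>\<open>a\<close> bounds the mean number of draws hitting a given set of at most
  \<open>k\<close> elements, and \<open>exp (real a * (lam - 1)) / lam ^ b\<close> is the Chernoff
  bound for at least \<open>b\<close> hits. The product is the fraction of the ideal gain that
  survives the restriction to \<open>b\<close> draws.\<close>

definition sampling_rate :: "nat \<Rightarrow> nat \<Rightarrow> real \<Rightarrow> bool" where
  "sampling_rate a b e \<longleftrightarrow> 0 < b \<and> a \<le> b \<and> b \<le> 2 * a \<and>
     (\<exists>lam\<ge>1. real a / real b * (1 - exp (real a * (lam - 1)) / lam ^ b) \<ge> 1 - e)"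

text \<open>The best \<open>b\<close> draws are worth at least the first \<open>b\<close> draws that
  fall into \<open>O'\<close>, and those are controlled by \<open>expect_first_hits\<close>.
  Monotonicity of \<open>G\<close> in \<open>w\<close> makes the ranking by \<open>w\<close> a
  ranking by \<open>G\<close> as well, so \<open>G\<close> may be a truncated form of the ranked
  quantity.\<close>

lemma expect_pick_ge:
  assumes N: "finite N" and k: "k > 0" and rate: "sampling_rate a b e"
    and O: "O' \<subseteq> N" "card O' \<le> k"
    and G: "\<And>x. G x \<ge> 0" "\<And>x y. w x \<le> w y \<Longrightarrow> G x \<le> G y"
  shows "expect (sample_pmf N k a b) (\<lambda>s. G (pick w s)) \<ge> (1 - e) * (\<Sum>v\<in>O'. G (Some v)) / real k"
proof -
  let ?m = "blocks N k"
  let ?D = "draw_pmf N (k * ?m)"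
  let ?R = "replicate_pmf (a * ?m) ?D"
  let ?X = "Some ` O'"
  define pr where "pr = expect ?D (indicator ?X)"
  define g where "g = expect ?D (\<lambda>x. indicator ?X x * G x)"
  obtain lam where ab: "0 < b" "a \<le> b" "b \<le> 2 * a" and lam: "lam \<ge> 1"
    and le: "real a / real b * (1 - exp (real a * (lam - 1)) / lam ^ b) \<ge> 1 - e"
    using rate unfolding sampling_rate_def by blast
  have bl: "?m > 0" by (simp add: blocks_def)
  then have M: "k * ?m > 0" using k by simp
  have fD: "finite (set_pmf ?D)" using M by (rule finite_draw_pmf)
  have fR: "finite (set_pmf ?R)" using fD by (rule finite_set_replicate_pmf)
  have sumO: "(\<Sum>v\<in>N. indicator ?X (Some v) * h v) = sum h O'" for h :: "_ \<Rightarrow> real"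
    using N O(1) by (intro sum.mono_neutral_cong_right) (auto simp: indicator_def)
  have g_eq: "g = (\<Sum>v\<in>O'. G (Some v)) / real (k * ?m)"
    unfolding g_def using sumO[of "\<lambda>v. G (Some v)"] bl
    by (subst expect_draw_pmf[OF N card_le_blocks[OF k] M]) simp
  have "pr = real (card O') / real (k * ?m)"
    unfolding pr_def using sumO[of "\<lambda>v. 1"] bl
    by (subst expect_draw_pmf[OF N card_le_blocks[OF k] M]) simp
  also have "\<dots> \<le> real k / real (k * ?m)" using O(2) by (intro divide_right_mono) auto
  finally have pr_le: "pr \<le> 1 / real ?m" using k by simp
  have pr0: "pr \<ge> 0" unfolding pr_def by (intro Bochner_Integration.integral_nonneg) auto
  have g0: "g \<ge> 0" unfolding g_def using G by (intro Bochner_Integration.integral_nonneg) auto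
  \<comment> \<open>The usual bound on the moment generating function:
    \<open>1 + x \<le> exp x\<close>, and each of the \<open>a * ?m\<close> draws hits with
    probability at most \<open>1 / ?m\<close>.\<close>
  have "(1 + pr * (lam - 1)) ^ (a * ?m) \<le> exp (pr * (lam - 1)) ^ (a * ?m)"
    using pr0 lam by (intro power_mono) (auto simp: exp_ge_add_one_self)
  also have "\<dots> = exp (real (a * ?m) * (pr * (lam - 1)))" by (rule exp_of_nat_mult[symmetric])
  also have "\<dots> \<le> exp (real a * (lam - 1))"
  proof -
    have "real (a * ?m) * (pr * (lam - 1)) \<le> real (a * ?m) * (1 / real ?m * (lam - 1))"
      using pr_le lam by (intro mult_left_mono mult_right_mono) auto
    also have "\<dots> = real a * (lam - 1)" using bl by simp
    finally show ?thesis by simp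
  qed
  finally have th: "(1 + pr * (lam - 1)) ^ (a * ?m) \<le> exp (real a * (lam - 1))" .
  let ?top = "\<lambda>xs. sum_list (map G (take b (sort_key (\<lambda>x. - w x) xs)))"
  have "real (a * ?m) * g * (1 - exp (real a * (lam - 1)) / lam ^ b)
     \<le> real (a * ?m) * g * (1 - (1 + pr * (lam - 1)) ^ (a * ?m) / lam ^ b)"
    using th lam g0 by (intro mult_left_mono diff_left_mono divide_right_mono) auto
  also have "\<dots> \<le> expect ?R (\<lambda>xs. sum_list (map G (take b (filter (\<lambda>x. x \<in> ?X) xs))))"
    unfolding g_def pr_def by (rule expect_first_hits[OF fD G(1) lam])
  also have "\<dots> \<le> expect ?R ?top"
  proof (rule expect_mono[OF fR])
    fix xs
    let ?Y = "mset (take b (filter (\<lambda>x. x \<in> ?X) xs))" and ?s = "sort_key (\<lambda>x. - w x) xs"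
    have "sorted_wrt (\<lambda>x y. G y \<le> G x) ?s"
    proof -
      have "sorted_wrt (\<lambda>x y. - w x \<le> - w y) ?s"
        using sorted_sort_key[of "\<lambda>x. - w x" xs] by (simp add: sorted_map)
      then show ?thesis by (rule sorted_wrt_mono_rel[rotated]) (use G(2) in auto)
    qed
    moreover have "?Y \<subseteq># mset ?s"
    proof -
      have "?Y \<subseteq># mset (filter (\<lambda>x. x \<in> ?X) xs)"
        by (metis append_take_drop_id mset_append mset_subset_eq_add_left)
      also have "\<dots> \<subseteq># mset ?s" by (simp add: mset_filter)
      finally show ?thesis .
    qed
    ultimately have "sum_mset (image_mset G ?Y) \<le> ?top xs"
      using G(1) by (intro sum_mset_le_sum_take) auto
    then show "sum_list (map G (take b (filter (\<lambda>x. x \<in> ?X) xs))) \<le> ?top xs"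
      by (simp only: mset_map[symmetric] sum_mset_sum_list)
  qed
  finally have "real (a * ?m) * g * (1 - exp (real a * (lam - 1)) / lam ^ b) / real b
      \<le> expect (sample_pmf N k a b) (\<lambda>s. G (pick w s))"
    using k ab by (simp add: expect_sample_pmf divide_right_mono)
  moreover have "real (a * ?m) * g * (1 - exp (real a * (lam - 1)) / lam ^ b) / real b
      = (\<Sum>v\<in>O'. G (Some v)) / real k * (real a / real b * (1 - exp (real a * (lam - 1)) / lam ^ b))"
    unfolding g_eq using bl by (simp add: field_simps)
  moreover have "(\<Sum>v\<in>O'. G (Some v)) / real k * (real a / real b * (1 - exp (real a * (lam - 1)) / lam ^ b))
     \<ge> (\<Sum>v\<in>O'. G (Some v)) / real k * (1 - e)"
    using le G(1) by (intro mult_left_mono divide_nonneg_nonneg sum_nonneg) auto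
  ultimately show ?thesis by (simp add: mult.commute)
qed

text \<open>A ratio \<open>a / b = 1 - x\<close> with \<open>x < e / 2\<close> loses little, and
  multiplying both numbers by a common \<open>t'\<close> turns the Chernoff term into the
  \<open>t'\<close>-th power of a number below \<open>1\<close>.\<close>

lemma sampling_rate_exists:
  assumes "e > 0"
  shows "\<exists>a b. sampling_rate a b e"
proof -
  obtain L :: nat where L: "1 / real L < e / 2" "L \<ge> 2"
  proof -
    obtain L where "real L > max 2 (2 / e)" using reals_Archimedean2 by blast
    then show ?thesis using assms by (intro that[of L]) (auto simp: field_simps)
  qed
  define x where "x = 1 / real L"
  have x: "0 < x" "x \<le> 1/2" "x < e/2" using L by (auto simp: x_def field_simps)
  \<comment> \<open>The Chernoff term for the pair \<open>L - 1\<close>, \<open>L\<close> at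
    \<open>lam = 1 + x / 2\<close>. It is below \<open>1\<close> because
    \<open>ln (1 + x / 2)\<close> exceeds \<open>x / 2 - x\<^sup>2 / 2\<close>, which times
    \<open>L\<close> is exactly \<open>(L - 1) * (x / 2)\<close> by
    \<open>L * x = 1\<close>.\<close>
  define base where "base = exp (real (L - 1) * (x / 2)) / (1 + x / 2) ^ L"
  have "ln (1 + x / 2) \<ge> x / 2 - (x / 2)\<^sup>2"
    using x by (intro ln_one_plus_pos_lower_bound) auto
  moreover have "(x / 2)\<^sup>2 < x\<^sup>2 / 2" using x by (simp add: power2_eq_square)
  ultimately have "ln (1 + x / 2) > x / 2 - x\<^sup>2 / 2" by linarith
  then have "real L * (x / 2 - x\<^sup>2 / 2) < real L * ln (1 + x / 2)"
    using L by (intro mult_strict_left_mono) auto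
  moreover have "real L * (x / 2 - x\<^sup>2 / 2) = real (L - 1) * (x / 2)"
    using L by (simp add: x_def power2_eq_square of_nat_diff field_simps)
  moreover have "exp (real L * ln (1 + x / 2)) = (1 + x / 2) ^ L"
    using x by (simp add: exp_of_nat_mult)
  ultimately have "exp (real (L - 1) * (x / 2)) < (1 + x / 2) ^ L" by (metis exp_less_cancel_iff)
  then have base: "0 < base" "base < 1" using x by (auto simp: base_def)
  obtain t where t: "base ^ t < x" using real_arch_pow_inv[OF x(1) base(2)] by blast
  define t' where "t' = Suc t"
  have "t' > 0" by (simp add: t'_def)
  have t': "base ^ t' < x"
  proof -
    have "base * base ^ t \<le> base ^ t" using base by (intro mult_left_le_one_le) auto
    with t show ?thesis unfolding t'_def power_Suc by linarith
  qed
  have "sampling_rate ((L - 1) * t') (L * t') e"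
    unfolding sampling_rate_def
  proof (intro conjI exI[of _ "1 + x / 2"])
    show "0 < L * t'" using L by (simp add: t'_def)
    show "(L - 1) * t' \<le> L * t'" by (intro mult_le_mono1) simp
    have "L \<le> 2 * (L - 1)" using L by simp
    then show "L * t' \<le> 2 * ((L - 1) * t')" unfolding mult.assoc[symmetric] by (rule mult_le_mono1)
    show "1 + x / 2 \<ge> 1" using x by simp
    have "exp (real ((L - 1) * t') * (1 + x / 2 - 1)) = exp (real (L - 1) * (x / 2)) ^ t'"
      by (simp add: exp_of_nat_mult[symmetric] mult_ac)
    then have "exp (real ((L - 1) * t') * (1 + x / 2 - 1)) / (1 + x / 2) ^ (L * t') = base ^ t'"
      by (simp add: base_def power_divide power_mult)
    moreover have "real ((L - 1) * t') / real (L * t') = 1 - x"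
    proof -
      have "real ((L - 1) * t') / real (L * t') = real (L - 1) / real L" using \<open>t' > 0\<close> by simp
      also have "\<dots> = 1 - x" using L by (simp add: x_def of_nat_diff diff_divide_distrib)
      finally show ?thesis .
    qed
    moreover have "(1 - x) * (1 - x) \<le> (1 - x) * (1 - base ^ t')"
      using t' x by (intro mult_left_mono) auto
    moreover have "(1 - x) * (1 - x) \<ge> 1 - e"
    proof -
      have "(1 - x) * (1 - x) = 1 - 2 * x + x * x" by (simp add: algebra_simps)
      moreover have "x * x \<ge> 0" by simp
      ultimately show ?thesis using x by linarith
    qed
    ultimately show "1 - e \<le> real ((L - 1) * t') / real (L * t') *
        (1 - exp (real ((L - 1) * t') * (1 + x / 2 - 1)) / (1 + x / 2) ^ (L * t'))"
      by simp
  qed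
  then show ?thesis by blast
qed

section \<open>Query programs and submodular functions\<close>

text \<open>Answers overwrite \<open>g\<close>, so the continuation receives a total function that
  agrees with the oracle on the listed sets and with the initial \<open>g\<close> elsewhere.\<close>

primrec ask :: "'a set list \<Rightarrow> ('a set \<Rightarrow> real) \<Rightarrow> (('a set \<Rightarrow> real) \<Rightarrow> 'a qtree) \<Rightarrow> 'a qtree" where
  "ask [] g c = c g"
| "ask (Q # Qs) g c = Query Q (\<lambda>r. ask Qs (g(Q := r)) c)"

lemma run_ask: "run (ask Qs g c) f = run (c (override_on g f (set Qs))) f"
proof (induction Qs arbitrary: g)
  case (Cons Q Qs)
  have eq: "override_on (g(Q := f Q)) f (set Qs) = override_on g f (set (Q # Qs))"
    by (auto simp: override_on_def)
  show ?case unfolding ask.simps run.simps Cons.IH eq ..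
qed simp

lemma num_queries_ask:
  "num_queries (ask Qs g c) f = length Qs + num_queries (c (override_on g f (set Qs))) f"
proof (induction Qs arbitrary: g)
  case (Cons Q Qs)
  have eq: "override_on (g(Q := f Q)) f (set Qs) = override_on g f (set (Q # Qs))"
    by (auto simp: override_on_def)
  show ?case unfolding ask.simps num_queries.simps Cons.IH eq by simp
qed simp

primrec loop :: "('s \<Rightarrow> 'w \<Rightarrow> 'a set list) \<Rightarrow> ('s \<Rightarrow> 'w \<Rightarrow> ('a set \<Rightarrow> real) \<Rightarrow> 's) \<Rightarrow>
    'w list \<Rightarrow> 's \<Rightarrow> ('s \<Rightarrow> 'a qtree) \<Rightarrow> 'a qtree" where
  "loop qs st [] s c = c s"
| "loop qs st (w # ws) s c = ask (qs s w) (\<lambda>_. 0) (\<lambda>g. loop qs st ws (st s w g) c)"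

text \<open>The premise \<open>local\<close> says that a step reads the oracle only at sets just
  queried. The tree therefore computes a plain \<open>foldl\<close> of steps with full access to
  \<open>f\<close>, and the probabilistic analysis can work with that fold alone.\<close>

lemma loop_correct:
  assumes "I s" "set ws \<subseteq> W"
    and inv: "\<And>s w. I s \<Longrightarrow> w \<in> W \<Longrightarrow> I (st s w f)"
    and local: "\<And>s w. I s \<Longrightarrow> w \<in> W \<Longrightarrow> st s w (override_on (\<lambda>_. 0) f (set (qs s w))) = st s w f"
    and len: "\<And>s w. I s \<Longrightarrow> w \<in> W \<Longrightarrow> length (qs s w) \<le> B"
  defines "r \<equiv> foldl (\<lambda>s w. st s w f) s ws"
  shows "I r" "run (loop qs st ws s c) f = run (c r) f"
    "num_queries (loop qs st ws s c) f \<le> B * length ws + num_queries (c r) f"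
proof -
  have "I r \<and> run (loop qs st ws s c) f = run (c r) f \<and>
    num_queries (loop qs st ws s c) f \<le> B * length ws + num_queries (c r) f"
    unfolding r_def using assms(1,2)
  proof (induction ws arbitrary: s)
    case (Cons w ws)
    have "I (st s w f)" using Cons.prems inv by auto
    moreover have "st s w (override_on (\<lambda>_. 0) f (set (qs s w))) = st s w f"
      using Cons.prems by (intro local) auto
    moreover have "length (qs s w) \<le> B" using Cons.prems by (intro len) auto
    ultimately show ?case
      using Cons.IH[of "st s w f"] Cons.prems by (simp add: run_ask num_queries_ask)
  qed simp
  then show "I r" "run (loop qs st ws s c) f = run (c r) f"
    "num_queries (loop qs st ws s c) f \<le> B * length ws + num_queries (c r) f" by auto
qed

section \<open>Single steps of random greedy and of local search\<close>

definition add_elem :: "'a set \<Rightarrow> 'a set \<Rightarrow> 'a option \<Rightarrow> 'a set" where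
  "add_elem P S x = (case x of None \<Rightarrow> S | Some v \<Rightarrow> if v \<in> P then insert v S else S)"

lemma add_elem_simps [simp]:
  "add_elem P S None = S"
  "add_elem P S (Some v) = (if v \<in> P then insert v S else S)"
  by (simp_all add: add_elem_def)

lemma add_elem_Un: "add_elem P S x \<union> T = add_elem P (S \<union> T) x"
  by (cases x) auto

lemma add_elem_subset: "add_elem P S x \<subseteq> S \<union> P"
  by (cases x) auto

text \<open>An element outside \<open>P\<close> acts as a dummy, like \<open>None\<close>, so
  barring elements needs no other sampling distribution. Refusing a loss makes the gain nonnegative
  and monotone in the ranking weight, as \<open>expect_pick_ge\<close> requires.\<close>

definition greedy_step ::
    "'a set \<Rightarrow> 'a set \<Rightarrow> 'a option list \<times> nat \<Rightarrow> ('a set \<Rightarrow> real) \<Rightarrow> 'a set" where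
  "greedy_step P S s g = (let A = add_elem P S (pick (\<lambda>x. g (add_elem P S x)) s)
     in if g S \<le> g A then A else S)"

definition greedy_queries :: "'a set \<Rightarrow> 'a set \<Rightarrow> 'a option list \<times> nat \<Rightarrow> 'a set list" where
  "greedy_queries P S s = S # map (add_elem P S) (fst s)"

lemma greedy_step_local:
  assumes "snd s < length (fst s)" "\<And>A. A \<in> set (greedy_queries P S s) \<Longrightarrow> g A = h A"
  shows "greedy_step P S s g = greedy_step P S s h"
proof -
  obtain xs j where s: "s = (xs, j)" by (cases s)
  have "pick (\<lambda>x. g (add_elem P S x)) s = pick (\<lambda>x. h (add_elem P S x)) s"
    unfolding s using assms(2) by (intro pick_cong) (auto simp: greedy_queries_def s)
  moreover have "pick (\<lambda>x. h (add_elem P S x)) s \<in> set xs"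
    unfolding s using assms(1) by (intro pick_in_set) (simp add: s)
  ultimately show ?thesis
    using assms(2) by (auto simp: greedy_step_def greedy_queries_def Let_def s)
qed

definition removals :: "nat \<Rightarrow> 'a set \<Rightarrow> 'a set set" where
  "removals k S = (if card S < k then {S} else {}) \<union> (\<lambda>v. S - {v}) ` S"

definition best_removal :: "nat \<Rightarrow> 'a set \<Rightarrow> ('a set \<Rightarrow> real) \<Rightarrow> 'a set" where
  "best_removal k S g = (SOME B. B \<in> removals k S \<and> (\<forall>B'\<in>removals k S. g B' \<le> g B))"

text \<open>A swap is judged by \<open>g B + (g A - g S)\<close>, which by submodularity is a lower bound for the value of
  \<open>B \<union> (A - S)\<close>. No further query is then needed after the choice of \<open>A\<close> and \<open>B\<close>.\<close>

definition swap_step ::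
    "'a set \<Rightarrow> nat \<Rightarrow> 'a set \<Rightarrow> 'a option list \<times> nat \<Rightarrow> ('a set \<Rightarrow> real) \<Rightarrow> 'a set" where
  "swap_step N k S s g = (
     let B = best_removal k S g; A = add_elem N S (pick (\<lambda>x. g (add_elem N S x)) s)
     in if g B + max 0 (g A - g S) > g S then (if g A > g S then B \<union> (A - S) else B) else S)"

definition swap_queries :: "'a set \<Rightarrow> 'a set \<Rightarrow> 'a option list \<times> nat \<Rightarrow> 'a set list" where
  "swap_queries N S s = greedy_queries N S s
     @ map (\<lambda>v. S - {v}) (SOME l. set l = S \<and> distinct l)"

lemma swap_queries:
  assumes "finite S"
  shows "set (swap_queries N S s) = set (greedy_queries N S s) \<union> (\<lambda>v. S - {v}) ` S"
    "length (swap_queries N S s) = 1 + length (fst s) + card S"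
proof -
  define l where "l = (SOME l. set l = S \<and> distinct l)"
  have "set l = S \<and> distinct l"
    unfolding l_def using finite_distinct_list[OF assms] by (rule someI_ex)
  then show "set (swap_queries N S s) = set (greedy_queries N S s) \<union> (\<lambda>v. S - {v}) ` S"
    "length (swap_queries N S s) = 1 + length (fst s) + card S"
    by (auto simp: swap_queries_def l_def[symmetric] greedy_queries_def distinct_card[symmetric])
qed

lemma best_removal:
  assumes "finite S" "k > 0"
  shows "best_removal k S g \<in> removals k S"
    "B' \<in> removals k S \<Longrightarrow> g B' \<le> g (best_removal k S g)"
proof -
  let ?R = "removals k S"
  have "finite ?R" "?R \<noteq> {}" using assms by (auto simp: removals_def)
  then have "\<exists>B. B \<in> ?R \<and> (\<forall>B'\<in>?R. g B' \<le> g B)"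
    using arg_min_if_finite[of ?R "\<lambda>B. - g B"] by (intro exI[of _ "arg_min_on (\<lambda>B. - g B) ?R"]) force
  from someI_ex[OF this] show "best_removal k S g \<in> ?R" "B' \<in> ?R \<Longrightarrow> g B' \<le> g (best_removal k S g)"
    unfolding best_removal_def by auto
qed

lemma swap_step_local:
  assumes "finite S" "k > 0" "snd s < length (fst s)"
    and eq: "\<And>A. A \<in> set (swap_queries N S s) \<Longrightarrow> g A = h A"
  shows "swap_step N k S s g = swap_step N k S s h"
proof -
  obtain xs j where s: "s = (xs, j)" by (cases s)
  have eq1: "\<And>A. A \<in> set (greedy_queries N S s) \<Longrightarrow> g A = h A" and eq2: "\<And>A. A \<in> removals k S \<Longrightarrow> g A = h A"
    using eq unfolding swap_queries(1)[OF assms(1)] removals_def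
    by (auto simp: greedy_queries_def split: if_splits)
  have pk: "pick (\<lambda>x. g (add_elem N S x)) s = pick (\<lambda>x. h (add_elem N S x)) s"
    unfolding s using eq1 by (intro pick_cong) (auto simp: greedy_queries_def s)
  have "pick (\<lambda>x. h (add_elem N S x)) s \<in> set xs"
    unfolding s using assms(3) by (intro pick_in_set) (simp add: s)
  then have A: "g (add_elem N S (pick (\<lambda>x. h (add_elem N S x)) s)) = h (add_elem N S (pick (\<lambda>x. h (add_elem N S x)) s))"
    and S: "g S = h S"
    using eq1 by (auto simp: greedy_queries_def s)
  have B: "best_removal k S g = best_removal k S h"
    unfolding best_removal_def using eq2 by (metis (no_types, lifting))
  have "g (best_removal k S h) = h (best_removal k S h)"
    using best_removal(1)[OF assms(1,2)] by (rule eq2)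
  then show ?thesis unfolding swap_step_def Let_def pk B A S by simp
qed

section \<open>Submodular inequalities and the expected progress of one step\<close>

locale submodular_instance =
  fixes N :: "'a set" and k :: nat and f :: "'a set \<Rightarrow> real" and a b :: nat and e :: real
  assumes finite_N: "finite N" and k_pos: "k > 0"
    and nonneg: "nonneg_on N f" and submod: "submodular_on N f"
    and rate: "sampling_rate a b e" and e: "0 \<le> e" "e \<le> 1 / 2"
begin

abbreviation "D \<equiv> sample_pmf N k a b"
abbreviation "opt \<equiv> opt_value N k f"

lemma ab: "0 < b" "a \<le> b" "b \<le> 2 * a"
  using rate by (auto simp: sampling_rate_def)

lemma finite_D: "finite (set_pmf D)"
  using finite_sample_pmf[OF k_pos ab(1)] .

lemma nonnegD: "A \<subseteq> N \<Longrightarrow> 0 \<le> f A"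
  using nonneg by (auto simp: nonneg_on_def)

lemma finite_subset_N: "A \<subseteq> N \<Longrightarrow> finite A"
  using finite_N by (rule rev_finite_subset)

lemma le_opt: "A \<subseteq> N \<Longrightarrow> card A \<le> k \<Longrightarrow> f A \<le> opt"
  unfolding opt_value_def using finite_N by (intro Max_ge) auto

lemma opt_attained: "\<exists>A. A \<subseteq> N \<and> card A \<le> k \<and> f A = opt"
proof -
  have "opt \<in> f ` {T. T \<subseteq> N \<and> card T \<le> k}"
    unfolding opt_value_def using finite_N by (intro Max_in) (auto intro!: exI[of _ "{}"])
  then show ?thesis by auto
qed

lemma opt_nonneg: "0 \<le> opt"
  using le_opt[of "{}"] nonnegD[of "{}"] by simp

lemma marginal_antimono:
  assumes "A \<subseteq> B" "B \<subseteq> N" "v \<in> N - B"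
  shows "f (insert v B) - f B \<le> f (insert v A) - f A"
  using submod assms unfolding submodular_on_def by (metis Un_insert_right sup_bot_right)

lemma marginal_set_antimono:
  assumes "finite W" "A \<subseteq> B" "B \<union> W \<subseteq> N" "B \<inter> W = {}"
  shows "f (B \<union> W) - f B \<le> f (A \<union> W) - f A"
  using assms
proof (induction W)
  case (insert v W)
  have "f (insert v (B \<union> W)) - f (B \<union> W) \<le> f (insert v (A \<union> W)) - f (A \<union> W)"
    using insert by (intro marginal_antimono) auto
  with insert show ?case by auto
qed simp

lemma lattice:
  assumes "X \<subseteq> N" "Y \<subseteq> N"
  shows "f (X \<union> Y) + f (X \<inter> Y) \<le> f X + f Y"
proof -
  have "f (Y \<union> (X - Y)) - f Y \<le> f ((X \<inter> Y) \<union> (X - Y)) - f (X \<inter> Y)"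
    using assms finite_subset_N[of "X - Y"] by (intro marginal_set_antimono) auto
  moreover have "Y \<union> (X - Y) = X \<union> Y" "(X \<inter> Y) \<union> (X - Y) = X" by auto
  ultimately show ?thesis by simp
qed

lemma sum_marginals_ge:
  assumes "finite V" "S \<union> V \<subseteq> N"
  shows "f (S \<union> V) - f S \<le> (\<Sum>v\<in>V. f (insert v S) - f S)"
  using assms
proof (induction V)
  case (insert v V)
  have "f (S \<union> insert v V) - f (S \<union> V) \<le> f (insert v S) - f S"
  proof (cases "v \<in> S")
    case True
    then show ?thesis by (simp add: insert_absorb)
  next
    case False
    then show ?thesis using insert marginal_antimono[of S "S \<union> V" v] by auto
  qed
  with insert show ?case by auto
qed simp

lemma sum_losses_le:
  assumes "finite V" "V \<subseteq> S" "S \<subseteq> N"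
  shows "(\<Sum>v\<in>V. f S - f (S - {v})) \<le> f S - f (S - V)"
  using assms
proof (induction V)
  case (insert v V)
  have "f (insert v (S - {v})) - f (S - {v}) \<le> f (insert v (S - insert v V)) - f (S - insert v V)"
    using insert by (intro marginal_antimono) auto
  moreover have "insert v (S - {v}) = S" "insert v (S - insert v V) = S - V"
    using insert by auto
  ultimately show ?case using insert by auto
qed simp

lemma greedy_step_value:
  "f (greedy_step P S s f) = f S + max 0 (f (add_elem P S (pick (\<lambda>x. f (add_elem P S x)) s)) - f S)"
  by (simp add: greedy_step_def Let_def)

lemma greedy_step_subset: "greedy_step P S s f \<subseteq> S \<union> P"
  by (simp add: greedy_step_def Let_def add_elem_subset)

text \<open>The positive marginals of \<open>Q \<inter> P\<close> add up to at least the gain from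
  joining all of it. Sampling loses a fraction \<open>e\<close>, charged to \<open>opt\<close>: by
  submodularity and nonnegativity that gain is at most \<open>f (Q \<inter> P)\<close>.\<close>

lemma greedy_step_expect_value:
  assumes "P \<subseteq> N" "S \<subseteq> N" "Q \<subseteq> N" "card Q \<le> k"
  shows "expect D (\<lambda>s. f (greedy_step P S s f))
       \<ge> (1 - 1 / k) * f S + (f (S \<union> (Q \<inter> P)) - e * opt) / k"
proof -
  let ?w = "\<lambda>x. f (add_elem P S x)"
  let ?G = "\<lambda>x. max 0 (?w x - f S)"
  let ?Q = "Q \<inter> P"
  let ?X = "f (S \<union> ?Q) - f S"
  have fQ: "finite ?Q" using assms finite_subset_N[of ?Q] by auto
  have "?X \<le> (\<Sum>v\<in>?Q. f (insert v S) - f S)"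
    using assms by (intro sum_marginals_ge fQ) auto
  also have "\<dots> \<le> (\<Sum>v\<in>?Q. ?G (Some v))"
    by (intro sum_mono) auto
  finally have X: "?X \<le> (\<Sum>v\<in>?Q. ?G (Some v))" .
  have "0 \<le> (\<Sum>v\<in>?Q. ?G (Some v))" by (intro sum_nonneg) auto
  with X have X': "max 0 ?X \<le> (\<Sum>v\<in>?Q. ?G (Some v))" by simp
  have "card ?Q \<le> k" using assms fQ finite_subset_N[of Q]
    by (meson Int_lower1 card_mono le_trans)
  then have hit: "(1 - e) * (\<Sum>v\<in>?Q. ?G (Some v)) / k \<le> expect D (\<lambda>s. ?G (pick ?w s))"
    using assms by (intro expect_pick_ge finite_N k_pos rate) auto
  have "f (S \<union> ?Q) + f (S \<inter> ?Q) \<le> f S + f ?Q" using assms by (intro lattice) auto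
  then have "?X \<le> opt"
    using nonnegD[of "S \<inter> ?Q"] assms le_opt[of ?Q] \<open>card ?Q \<le> k\<close> by fastforce
  then have "e * max 0 ?X \<le> e * opt" using e opt_nonneg by (intro mult_left_mono) auto
  then have "?X - e * opt \<le> (1 - e) * max 0 ?X" by (simp add: algebra_simps)
  also have "\<dots> \<le> (1 - e) * (\<Sum>v\<in>?Q. ?G (Some v))"
    using X' e by (intro mult_left_mono) auto
  finally have "(?X - e * opt) / k \<le> (1 - e) * (\<Sum>v\<in>?Q. ?G (Some v)) / k"
    by (rule divide_right_mono) simp
  moreover have "expect D (\<lambda>s. f (greedy_step P S s f)) = f S + expect D (\<lambda>s. ?G (pick ?w s))"
    unfolding greedy_step_value using finite_D by (simp add: expect_add)
  moreover have "(1 - 1 / k) * f S + (f (S \<union> ?Q) - e * opt) / k = f S + (?X - e * opt) / k"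
    by (simp add: diff_divide_distrib add_divide_distrib algebra_simps)
  ultimately show ?thesis using hit by linarith
qed

text \<open>Each element is picked with probability at most \<open>1 / k\<close>, and the losses of
  all harmful elements add up to at most the loss from inserting them together, which
  \<open>lower\<close> bounds by \<open>f (S \<union> Q) + c\<close>. The shift \<open>c\<close>
  allows for lower bounds other than \<open>0\<close>.\<close>

lemma greedy_step_expect_union:
  assumes "P \<subseteq> N" "S \<subseteq> N" "Q \<subseteq> N"
    and lower: "\<And>V. V \<subseteq> P \<Longrightarrow> 0 \<le> f (S \<union> Q \<union> V) + c"
  shows "expect D (\<lambda>s. f (greedy_step P S s f \<union> Q) + c) \<ge> (1 - 1 / k) * (f (S \<union> Q) + c)"
proof -
  let ?w = "\<lambda>x. f (add_elem P S x)"
  let ?T = "S \<union> Q"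
  let ?l = "\<lambda>x. max 0 (f ?T - f (add_elem P ?T x))"
  define V where "V = {v \<in> P. f ?T - f (insert v ?T) > 0}"
  have V: "V \<subseteq> P" "V \<subseteq> N" using assms(1) by (auto simp: V_def)
  have "(\<Sum>v\<in>N. ?l (Some v)) = (\<Sum>v\<in>V. f ?T - f (insert v ?T))"
    using finite_N V by (intro sum.mono_neutral_cong_right) (auto simp: V_def)
  also have "\<dots> = - (\<Sum>v\<in>V. f (insert v ?T) - f ?T)"
    by (simp add: sum_negf[symmetric])
  also have "\<dots> \<le> f ?T - f (?T \<union> V)"
    using sum_marginals_ge[of V ?T] V assms finite_subset_N[of V] by auto
  also have "\<dots> \<le> f ?T + c" using lower[OF V(1)] by simp
  finally have "(\<Sum>v\<in>N. ?l (Some v)) / k \<le> (f ?T + c) / k" by (rule divide_right_mono) simp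
  moreover have "expect D (\<lambda>s. ?l (pick ?w s)) \<le> (\<Sum>v\<in>N. ?l (Some v)) / k"
    by (intro expect_pick_le finite_N k_pos ab) auto
  moreover have "expect D (\<lambda>s. (f ?T + c) - ?l (pick ?w s)) \<le> expect D (\<lambda>s. f (greedy_step P S s f \<union> Q) + c)"
    by (intro expect_mono finite_D) (auto simp: greedy_step_def Let_def add_elem_Un)
  moreover have "expect D (\<lambda>s. (f ?T + c) - ?l (pick ?w s)) = (f ?T + c) - expect D (\<lambda>s. ?l (pick ?w s))"
    using finite_D by (simp add: expect_diff del: add_diff_eq)
  moreover have "(1 - 1 / k) * (f ?T + c) = (f ?T + c) - (f ?T + c) / k" by (simp add: algebra_simps add_divide_distrib)
  ultimately show ?thesis by linarith
qed

lemma swap_step_feasible: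
  assumes "S \<subseteq> N" "card S \<le> k"
  shows "swap_step N k S s f \<subseteq> N" "card (swap_step N k S s f) \<le> k"
    "f (swap_step N k S s f) \<ge> f S + max 0 (f (best_removal k S f) +
       max 0 (f (add_elem N S (pick (\<lambda>x. f (add_elem N S x)) s)) - f S) - f S)"
proof -
  define B where "B = best_removal k S f"
  define x where "x = pick (\<lambda>x. f (add_elem N S x)) s"
  define A where "A = add_elem N S x"
  define S' where "S' = swap_step N k S s f"
  have finS: "finite S" using assms finite_subset_N by auto
  have BR: "B \<in> removals k S" unfolding B_def using best_removal(1)[OF finS k_pos] .
  have cS: "card (S - {v}) < k" if "v \<in> S" for v
    using that assms(2) finS k_pos by (simp add: card_Diff_singleton)
  have B: "B \<subseteq> S" "card B < k"
    using BR cS by (auto simp: removals_def split: if_splits)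
  have S': "S' = (if f B + max 0 (f A - f S) > f S then (if f A > f S then B \<union> (A - S) else B) else S)"
    unfolding S'_def swap_step_def Let_def B_def A_def x_def ..
  have "S' \<subseteq> N \<and> card S' \<le> k \<and> f S' \<ge> f S + max 0 (f B + max 0 (f A - f S) - f S)"
  proof (cases "f A > f S")
    case True
    then obtain v where x: "x = Some v" by (cases x) (auto simp: A_def)
    then have v: "v \<in> N - S" "A = insert v S"
      using True by (auto simp: A_def insert_absorb split: if_splits)
    have "f (insert v S) - f S \<le> f (insert v B) - f B"
      using v B assms by (intro marginal_antimono) auto
    moreover have "A - S = {v}" using v by auto
    moreover have "card (insert v B) \<le> k" using B finS finite_subset[of B S] by (simp add: card_insert_if)
    ultimately show ?thesis using S' assms B v True by auto
  next
    case False
    then show ?thesis using S' assms B by auto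
  qed
  then show "swap_step N k S s f \<subseteq> N" "card (swap_step N k S s f) \<le> k"
    "f (swap_step N k S s f) \<ge> f S + max 0 (f (best_removal k S f) +
       max 0 (f (add_elem N S (pick (\<lambda>x. f (add_elem N S x)) s)) - f S) - f S)"
    unfolding S'_def B_def A_def x_def by auto
qed

text \<open>The best removal loses at most the average loss over \<open>S - Q\<close>. If
  \<open>Q - S\<close> is larger than \<open>S - Q\<close>, then \<open>S\<close> has a free place,
  the loss is at most \<open>0\<close>, and a larger multiple of it is only smaller.\<close>

lemma best_removal_loss:
  assumes "S \<subseteq> N" "Q \<subseteq> N" "card S \<le> k" "card Q \<le> k"
  shows "real (card (S - Q)) * (f S - f (best_removal k S f)) \<le> f S - f (S \<inter> Q)"
    "real (max (card (Q - S)) (card (S - Q))) * (f S - f (best_removal k S f)) \<le> f S - f (S \<inter> Q)"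
proof -
  let ?d = "f S - f (best_removal k S f)"
  have fin: "finite S" "finite Q" using assms finite_subset_N by auto
  have "real (card (S - Q)) * ?d = (\<Sum>v\<in>S - Q. ?d)" by simp
  also have "\<dots> \<le> (\<Sum>v\<in>S - Q. f S - f (S - {v}))"
    using best_removal(2)[OF fin(1) k_pos] by (intro sum_mono diff_left_mono) (auto simp: removals_def)
  also have "\<dots> \<le> f S - f (S - (S - Q))" using fin assms by (intro sum_losses_le) auto
  also have "S - (S - Q) = S \<inter> Q" by auto
  finally show loss: "real (card (S - Q)) * ?d \<le> f S - f (S \<inter> Q)" .
  show "real (max (card (Q - S)) (card (S - Q))) * ?d \<le> f S - f (S \<inter> Q)"
  proof (cases "card (Q - S) \<le> card (S - Q)")
    case True
    then show ?thesis using loss by (simp add: max_def)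
  next
    case False
    have "card S = card (S - Q) + card (S \<inter> Q)" "card Q = card (Q - S) + card (S \<inter> Q)"
      using fin by (metis card_Int_Diff add.commute, metis card_Int_Diff add.commute Int_commute)
    then have "card S < k" using False assms by simp
    then have "?d \<le> 0" using best_removal(2)[OF fin(1) k_pos, of S] by (simp add: removals_def)
    then have "real (card (Q - S)) * ?d \<le> real (card (S - Q)) * ?d"
      using False by (intro mult_right_mono_neg) auto
    then show ?thesis using loss False by (simp add: max_def)
  qed
qed

text \<open>The two gains mirror the two local optimality conditions. Removal alone yields the
  comparison with \<open>S \<inter> Q\<close>; insertion of a sampled element, paid for by one
  removal, yields the comparison with the average of union and intersection.\<close>

lemma swap_step_expect:
  assumes S: "S \<subseteq> N" "card S \<le> k" and Q: "Q \<subseteq> N" "card Q \<le> k"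
  defines "gain \<equiv> expect D (\<lambda>s. f (swap_step N k S s f)) - f S"
  shows "0 \<le> gain" "(f (S \<inter> Q) - f S) / k \<le> gain"
    "(1 - e) * (f (S \<union> Q) + f (S \<inter> Q) - 2 * f S) / k \<le> gain"
proof -
  let ?w = "\<lambda>x. f (add_elem N S x)"
  define d where "d = f S - f (best_removal k S f)"
  \<comment> \<open>\<open>g0\<close> is the gain of the removal alone, available for every sample.
    Splitting it off from \<open>?G\<close> lets it count \<open>k\<close> times in the average,
    independently of how few elements \<open>Q - S\<close> has.\<close>
  define g0 where "g0 = max 0 (- d)"
  let ?G = "\<lambda>x. max 0 (max 0 (?w x - f S) - d) - g0"
  have fin: "finite S" "finite Q" using S Q finite_subset_N by auto
  have g0: "0 \<le> g0" "- d \<le> g0" by (auto simp: g0_def)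
  have "expect D (\<lambda>s. (f S + g0) + ?G (pick ?w s)) \<le> expect D (\<lambda>s. f (swap_step N k S s f))"
  proof (rule expect_mono[OF finite_D])
    fix s
    show "f S + g0 + ?G (pick ?w s) \<le> f (swap_step N k S s f)"
      using swap_step_feasible(3)[OF S, of s] by (simp add: d_def algebra_simps)
  qed
  then have gain: "g0 + expect D (\<lambda>s. ?G (pick ?w s)) \<le> gain"
    unfolding gain_def using finite_D by (subst (asm) expect_add) auto
  have G0: "0 \<le> ?G x" for x by (auto simp: g0_def)
  then have "0 \<le> expect D (\<lambda>s. ?G (pick ?w s))"
    by (intro Bochner_Integration.integral_nonneg)
  then have gg: "g0 \<le> gain" using gain by simp
  then show gain0: "0 \<le> gain" using g0 by simp
  show "(f (S \<inter> Q) - f S) / k \<le> gain"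
  proof -
    have "f (S \<inter> Q) - f S \<le> real (card (S - Q)) * (- d)"
      using best_removal_loss(1)[OF S(1) Q(1) S(2) Q(2)] unfolding d_def[symmetric] by simp
    also have "\<dots> \<le> real (card (S - Q)) * g0" using g0 by (intro mult_left_mono) auto
    also have "\<dots> \<le> real k * g0"
    proof -
      have "card (S - Q) \<le> card S" using fin by (intro card_mono) auto
      then show ?thesis using S g0 by (intro mult_right_mono) auto
    qed
    also have "\<dots> \<le> real k * gain" using gg by (intro mult_left_mono) auto
    finally show ?thesis using k_pos by (simp add: field_simps)
  qed
  let ?m = "card (Q - S)"
  let ?M = "max ?m (card (S - Q))"
  have M: "?M \<le> k"
    using fin S Q by (meson Diff_subset card_mono le_trans max.boundedI)
  have "(1 - e) * (\<Sum>v\<in>Q - S. ?G (Some v)) / k \<le> expect D (\<lambda>s. ?G (pick ?w s))"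
  proof (rule expect_pick_ge[OF finite_N k_pos rate _ _ G0])
    show "Q - S \<subseteq> N" using Q by auto
    show "card (Q - S) \<le> k" using M by simp
  qed auto
  moreover have "(1 - e) * (real k * g0) / k \<le> g0"
    using e g0 k_pos by (simp add: mult_left_le_one_le)
  ultimately have hit: "(1 - e) * ((\<Sum>v\<in>Q - S. ?G (Some v)) + real k * g0) / k \<le> gain"
    using gain by (simp add: distrib_left add_divide_distrib)
  have "f (S \<union> Q) + f (S \<inter> Q) - 2 * f S \<le> (\<Sum>v\<in>Q - S. ?G (Some v)) + real k * g0"
  proof -
    have "f (S \<union> Q) - f S \<le> (\<Sum>v\<in>Q - S. f (insert v S) - f S)"
      using sum_marginals_ge[of "Q - S" S] fin S Q by auto
    also have "\<dots> \<le> (\<Sum>v\<in>Q - S. ?G (Some v) + (d + g0))"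
      using Q by (intro sum_mono) auto
    also have "\<dots> = (\<Sum>v\<in>Q - S. ?G (Some v)) + real ?m * (d + g0)"
      unfolding sum.distrib by (simp add: distrib_left)
    finally have 1: "f (S \<union> Q) - f S \<le> (\<Sum>v\<in>Q - S. ?G (Some v)) + real ?m * (d + g0)" .
    have "real ?m * (d + g0) \<le> real ?M * (d + g0)"
      using g0 by (intro mult_right_mono) auto
    also have "\<dots> = real ?M * d + real ?M * g0" by (simp add: distrib_left)
    also have "\<dots> \<le> (f S - f (S \<inter> Q)) + real k * g0"
      using best_removal_loss(2)[OF S(1) Q(1) S(2) Q(2)] g0 M
      unfolding d_def[symmetric] by (intro add_mono mult_right_mono) auto
    finally show ?thesis using 1 by simp
  qed
  then have "(1 - e) * (f (S \<union> Q) + f (S \<inter> Q) - 2 * f S) / k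
      \<le> (1 - e) * ((\<Sum>v\<in>Q - S. ?G (Some v)) + real k * g0) / k"
    using e by (intro divide_right_mono mult_left_mono) auto
  then show "(1 - e) * (f (S \<union> Q) + f (S \<inter> Q) - 2 * f S) / k \<le> gain"
    using hit by (rule order_trans)
qed

end

section \<open>The approximation ratio\<close>

text \<open>The coefficients of \<open>f Q\<close>, \<open>- f (Z \<inter> Q)\<close> and \<open>- f (Z \<union> Q)\<close> in the value of the guided greedy solution.\<close>

definition greedy_opt_coeff :: "nat \<Rightarrow> nat \<Rightarrow> real" where
  "greedy_opt_coeff k h = (let q = 1 - 1 / real k in
     q ^ (k - h) * (1 - q ^ h) + real (k - h) / real k * q ^ (k - h - 1))"

definition greedy_inter_coeff :: "nat \<Rightarrow> nat \<Rightarrow> real" where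
  "greedy_inter_coeff k h = (let q = 1 - 1 / real k in q ^ (k - h) * (1 - q ^ h))"

definition greedy_union_coeff :: "nat \<Rightarrow> nat \<Rightarrow> real" where
  "greedy_union_coeff k h = (let q = 1 - 1 / real k in
     q ^ (k - h) * (1 - q ^ h) - real h / real k * q ^ (k - 1)
     + real (k - h) / real k * q ^ (k - h - 1) * (1 - q ^ h))"

section \<open>Numerical bounds for the coefficients\<close>

lemma exp_minus_1_lower: "exp (-1 :: real) \<ge> 3678 / 10000"
proof -
  obtain t where "exp (-1 :: real) = (\<Sum>m<8. (-1) ^ m / fact m) + (exp t / fact 8) * (-1) ^ 8"
    using Maclaurin_exp_le[of "-1" 8] by blast
  moreover have "(exp t / fact 8) * (-1) ^ 8 \<ge> 0" by simp
  moreover have "(\<Sum>m<8. (-1) ^ m / fact m :: real) \<ge> 3678 / 10000"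
    by (simp add: eval_nat_numeral)
  ultimately show ?thesis by linarith
qed

text \<open>\<open>-(63/100)\<close> is \<open>s - 1\<close> at the expansion point
  \<open>s = 37/100\<close>. Stopping before an even power leaves a nonnegative remainder.\<close>

lemma exp_minus_63_lower: "exp (-(63/100) :: real) \<ge> 5325 / 10000"
proof -
  let ?y = "-(63/100) :: real"
  obtain t where "exp ?y = (\<Sum>m<6. ?y ^ m / fact m) + (exp t / fact 6) * ?y ^ 6"
    using Maclaurin_exp_le[of ?y 6] by blast
  moreover have "(exp t / fact 6) * ?y ^ 6 \<ge> 0" by simp
  moreover have "(\<Sum>m<6. ?y ^ m / fact m) \<ge> 5325 / 10000"
    by (simp add: eval_nat_numeral)
  ultimately show ?thesis by linarith
qed

text \<open>With \<open>r = 963/2500 = 0.3852\<close>, the constants are \<open>1 - 2r\<close>, \<open>1 - r\<close> and \<open>3r - 1\<close>; the limit of the right-hand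
  side of \<open>ratio_identity\<close> below, as \<open>k \<rightarrow> \<infinity>\<close> and \<open>h/k \<rightarrow> s\<close>, is nonnegative.
  The exponential is expanded around \<open>s = 0.37\<close>.\<close>

lemma limit_ratio_lower:
  fixes s :: real
  assumes "1/3 \<le> s" "s \<le> 2/5"
  shows "exp (s - 1) * (574/2500 + 1537/2500 * (1 - s)) + exp (-1) * (389/2500) \<ge> 963/2500"
proof -
  define x where "x = s - 37/100"
  have x: "-(11/300) \<le> x" "x \<le> 3/100" using assms by (auto simp: x_def)
  have ax: "\<bar>x\<bar> \<le> 11/300" using x by auto
  have "exp x \<ge> 1 + x + x\<^sup>2 / 2 + x ^ 3 / 6"
  proof -
    obtain t where "exp x = (\<Sum>m<4. x ^ m / fact m) + (exp t / fact 4) * x ^ 4"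
      using Maclaurin_exp_le[of x 4] by blast
    moreover have "(exp t / fact 4) * x ^ 4 \<ge> 0" by simp
    ultimately show ?thesis by (simp add: eval_nat_numeral)
  qed
  moreover have "\<bar>x ^ 3\<bar> \<le> (11/300) ^ 3" unfolding power_abs using ax by (intro power_mono) auto
  ultimately have ex: "exp x \<ge> 1 + x + x\<^sup>2 / 2 - 1 / 100000" by (simp add: eval_nat_numeral)
  have pos: "1 + x + x\<^sup>2 / 2 - 1 / 100000 \<ge> 0" using x zero_le_power2[of x] by linarith
  have "exp (s - 1) = exp (-(63/100)) * exp x" by (simp add: x_def exp_add[symmetric])
  also have "\<dots> \<ge> 5325 / 10000 * (1 + x + x\<^sup>2 / 2 - 1 / 100000)"
    using ex exp_minus_63_lower pos by (intro mult_mono) auto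
  finally have E: "exp (s - 1) \<ge> 5325 / 10000 * (1 + x + x\<^sup>2 / 2 - 1 / 100000)" .
  have lin: "574/2500 + 1537/2500 * (1 - s) = 154231/250000 - 1537/2500 * x"
    by (simp add: x_def field_simps)
  have lin0: "154231/250000 - 1537/2500 * x \<ge> 0" using x by simp
  have "\<bar>x\<bar>\<^sup>2 \<le> (11/300)\<^sup>2" using ax by (intro power_mono) auto
  then have x2: "x\<^sup>2 \<le> 121/90000" by (simp add: power2_eq_square)
  \<comment> \<open>The expansion point nearly cancels the linear term: its coefficient is
    \<open>531/250000\<close>. The product thus stays close to its value at \<open>x = 0\<close> on
    the whole range.\<close>
  have "(1 + x + x\<^sup>2 / 2 - 1 / 100000) * (154231/250000 - 1537/2500 * x) \<ge> 6163/10000"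
  proof -
    have "\<bar>x\<^sup>2 * x\<bar> \<le> 121/90000 * (11/300)"
      unfolding abs_mult using ax x2 by (intro mult_mono) auto
    moreover have "(1 + x + x\<^sup>2 / 2 - 1 / 100000) * (154231/250000 - 1537/2500 * x)
      = 154231/250000 + (154231/250000 - 1537/2500) * x + (154231/500000 - 1537/2500) * x\<^sup>2
         - 1537/5000 * (x\<^sup>2 * x) - 1/100000 * (154231/250000 - 1537/2500 * x)"
      by (simp add: field_simps power2_eq_square)
    moreover have "154231/250000 + (154231/250000 - 1537/2500) * x + (154231/500000 - 1537/2500) * y
         - 1537/5000 * w - 1/100000 * (154231/250000 - 1537/2500 * x) \<ge> 6163/10000"
      if "y \<le> 121/90000" "\<bar>w\<bar> \<le> 121/90000 * (11/300)" for y w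
      using x that by (simp add: abs_le_iff field_simps)
    ultimately show ?thesis using x2 by presburger
  qed
  then have "5325/10000 * (6163/10000)
      \<le> 5325/10000 * ((1 + x + x\<^sup>2 / 2 - 1 / 100000) * (154231/250000 - 1537/2500 * x))"
    by (rule mult_left_mono) simp
  also have "\<dots> \<le> exp (s - 1) * (154231/250000 - 1537/2500 * x)"
    unfolding mult.assoc[symmetric] using E lin0 by (rule mult_right_mono)
  finally have "exp (s - 1) * (154231/250000 - 1537/2500 * x) \<ge> 5325/10000 * (6163/10000)" .
  moreover have "exp (-1) * (389/2500) \<ge> 3678/10000 * (389/2500 :: real)"
    using exp_minus_1_lower by simp
  ultimately show ?thesis unfolding lin by linarith
qed

text \<open>\<open>- ln (1 - 1 / k)\<close> is the integral of \<open>1 / x\<close> from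
  \<open>k - 1\<close> to \<open>k\<close>, bounded by the trapezoidal rule. As \<open>j\<close> is
  one less than \<open>k * (1 - s)\<close>, a surplus factor \<open>1 + 1 / (2 * k)\<close> remains,
  which later absorbs a factor \<open>1 - 1 / k\<close>.\<close>

lemma geometric_lower:
  assumes "k \<ge> (2::nat)" "j < k" "s = real (k - j - 1) / real k"
  shows "(1 - 1 / real k) ^ j \<ge> exp (s - 1) * (1 + 1 / (2 * real k))"
proof -
  let ?q = "1 - 1 / real k"
  have q: "?q > 0" using assms by simp
  have "- ln ?q \<le> (1 / (real k - 1) + 1 / real k) / 2"
  proof -
    have "ln ((real k - 1) + 1) - ln (real k - 1) \<le> 1 * (inverse (real k - 1) + inverse (real k - 1 + 1)) / 2"
      using assms by (intro ln_inverse_approx_le) auto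
    moreover have "?q = (real k - 1) / real k" using assms by (simp add: field_simps)
    then have "ln ?q = ln (real k - 1) - ln (real k)" using assms by (simp add: ln_div)
    ultimately show ?thesis by (simp add: inverse_eq_divide)
  qed
  then have "real j * - ln ?q \<le> real j * ((1 / (real k - 1) + 1 / real k) / 2)"
    by (rule mult_left_mono) simp
  also have "\<dots> \<le> (1 - s) - 1 / (2 * real k)"
  proof -
    have s: "1 - s = (real j + 1) / real k" using assms by (simp add: of_nat_diff field_simps)
    \<comment> \<open>The two sides differ by \<open>k - 1 - j\<close>.\<close>
    have "real j * (2 * real k - 1) \<le> (2 * real j + 1) * (real k - 1)"
      using assms by (simp add: algebra_simps)
    then have "real j * (2 * real k - 1) / (2 * real k * (real k - 1))
        \<le> (2 * real j + 1) * (real k - 1) / (2 * real k * (real k - 1))"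
      using assms by (intro divide_right_mono) auto
    moreover have "real j * ((1 / (real k - 1) + 1 / real k) / 2)
        = real j * (2 * real k - 1) / (2 * real k * (real k - 1))"
      using assms by (simp add: field_simps)
    moreover have "(2 * real j + 1) * (real k - 1) / (2 * real k * (real k - 1)) = 1 - s - 1 / (2 * real k)"
      using assms(1) unfolding s by (simp add: field_simps)
    ultimately show ?thesis by linarith
  qed
  finally have "(s - 1) + 1 / (2 * real k) \<le> real j * ln ?q" by simp
  then have "exp (s - 1) * exp (1 / (2 * real k)) \<le> exp (real j * ln ?q)"
    by (simp add: exp_add[symmetric])
  moreover have "exp (real j * ln ?q) = ?q ^ j" using q by (simp add: exp_of_nat_mult)
  moreover have "exp (s - 1) * (1 + 1 / (2 * real k)) \<le> exp (s - 1) * exp (1 / (2 * real k))"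
    by (intro mult_left_mono) (auto simp: exp_ge_add_one_self)
  ultimately show ?thesis by linarith
qed

text \<open>Grouping by \<open>q ^ (k - h - 1)\<close> and \<open>q ^ (k - 1)\<close> leaves two
  powers to which \<open>geometric_lower\<close> applies, the second with
  \<open>s = 0\<close>.\<close>

lemma ratio_identity:
  fixes r :: real
  assumes "h < k" "q = 1 - 1 / real k" "s = real h / real k"
  shows "greedy_opt_coeff k h - r * (1 + greedy_inter_coeff k h + greedy_union_coeff k h)
    = q ^ (k - h - 1) * ((1 - 2 * r) * q + (1 - r) * (1 - s)) + q ^ (k - 1) * (r - (1 - 2 * r) * q) - r"
proof -
  define E F where "E = q ^ (k - h - 1)" and "F = q ^ h"
  have pk: "q ^ (k - h) = E * q" using assms(1) power_minus_mult[of "k - h" q] by (simp add: E_def)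
  have pk1: "q ^ (k - 1) = E * F" using assms(1) unfolding E_def F_def by (simp flip: power_add)
  have ds: "real (k - h) / real k = 1 - s" using assms by (simp add: of_nat_diff diff_divide_distrib)
  show ?thesis
    unfolding greedy_opt_coeff_def greedy_inter_coeff_def greedy_union_coeff_def Let_def
      assms(2)[symmetric] assms(3)[symmetric] pk pk1 ds E_def[symmetric] F_def[symmetric]
    by (simp add: algebra_simps)
qed

text \<open>These bounds make the coefficients usable as weights of the local optimality conditions.
  With \<open>F = q ^ h\<close> and \<open>s = h / k\<close>, union below intersection is
  Bernoulli's \<open>1 - s \<le> F\<close>; nonnegativity follows from
  \<open>F \<le> exp (- s)\<close> and, for \<open>h > 0\<close>,
  \<open>s \<le> 1 / 2 \<le> q\<close>.\<close>

lemma coeff_properties: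
  assumes "h < k"
  shows "0 \<le> greedy_inter_coeff k h" "greedy_inter_coeff k h \<le> 1"
    "greedy_union_coeff k h \<le> greedy_inter_coeff k h"
    "2 * h \<le> k \<Longrightarrow> 0 \<le> greedy_union_coeff k h"
proof -
  define q s where "q = 1 - 1 / real k" and "s = real h / real k"
  define E F where "E = q ^ (k - h - 1)" and "F = q ^ h"
  have k: "k > 0" using assms by simp
  have q: "0 \<le> q" "q \<le> 1" using k by (auto simp: q_def)
  have EF: "0 \<le> E" "E \<le> 1" "0 \<le> F" "F \<le> 1" using q by (auto simp: E_def F_def power_le_one)
  have pk: "q ^ (k - h) = E * q" using assms(1) power_minus_mult[of "k - h" q] by (simp add: E_def)
  have pk1: "q ^ (k - 1) = E * F" using assms(1) unfolding E_def F_def by (simp flip: power_add)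
  have ds: "real (k - h) / real k = 1 - s" using assms k by (simp add: s_def of_nat_diff diff_divide_distrib)
  have inter: "greedy_inter_coeff k h = E * q * (1 - F)"
    unfolding greedy_inter_coeff_def Let_def q_def[symmetric] pk F_def ..
  show "0 \<le> greedy_inter_coeff k h" unfolding inter using q EF by simp
  show "greedy_inter_coeff k h \<le> 1" unfolding inter using q EF by (intro mult_le_one) auto
  have union: "greedy_union_coeff k h = E * q * (1 - F) - E * (s * F - (1 - s) * (1 - F))"
    unfolding greedy_union_coeff_def Let_def q_def[symmetric] pk pk1 F_def[symmetric] E_def[symmetric] ds s_def[symmetric]
    by (simp add: algebra_simps)
  have "1 + real h * (q - 1) \<le> F"
    using Bernoulli_inequality[of "q - 1" h] q by (simp add: F_def)
  then have F1: "1 - s \<le> F" using k by (simp add: q_def s_def)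
  then have "s * F - (1 - s) * (1 - F) \<ge> 0" by (simp add: algebra_simps)
  then show "greedy_union_coeff k h \<le> greedy_inter_coeff k h"
    unfolding inter union using EF by simp
  assume h2: "2 * h \<le> k"
  show "0 \<le> greedy_union_coeff k h"
  proof (cases "h = 0")
    case True
    then show ?thesis by (simp add: greedy_union_coeff_def)
  next
    case False
    have s: "0 \<le> s" "s \<le> 1 / 2" using h2 k by (auto simp: s_def field_simps)
    have "k \<ge> 2" using h2 False by simp
    then have q2: "q \<ge> 1 / 2" by (simp add: q_def field_simps)
    have "F * (1 + s) \<le> 1"
    proof -
      have "q \<le> exp (- (1 / real k))" using exp_ge_add_one_self[of "- (1 / real k)"] by (simp add: q_def)
      then have "F \<le> exp (- (1 / real k)) ^ h" unfolding F_def using q by (intro power_mono) auto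
      also have "\<dots> = exp (- s)" by (simp add: exp_of_nat_mult[symmetric] s_def)
      finally have "F * (1 + s) \<le> exp (- s) * exp s"
        using s by (intro mult_mono) (auto simp: exp_ge_add_one_self)
      then show ?thesis by (simp add: exp_minus)
    qed
    then have "(1 - F) * (1 + s) \<ge> s" by (simp add: algebra_simps)
    moreover have "(1 - F) * (1 + q) \<ge> (1 - F) * (1 + s)"
      using EF s q2 by (intro mult_left_mono) auto
    ultimately have "q * (1 - F) - (s * F - (1 - s) * (1 - F)) \<ge> 0" by (simp add: algebra_simps)
    then have "E * (q * (1 - F) - (s * F - (1 - s) * (1 - F))) \<ge> 0" using EF by simp
    then show ?thesis unfolding union by (simp add: algebra_simps)
  qed
qed

lemma good_switching_time:
  assumes "k > (0::nat)"
  shows "\<exists>h<k. 2 * h \<le> k \<and>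
    greedy_opt_coeff k h \<ge> 963/2500 * (1 + greedy_inter_coeff k h + greedy_union_coeff k h)"
proof (cases "k \<le> 11")
  case True
  then have "k \<in> {1..11}" using assms by auto
  then have "k \<in> {1,2,3,4,5,6,7,8,9,10,11}" by (auto simp: eval_nat_numeral le_Suc_eq)
  \<comment> \<open>For \<open>h = 0\<close> the other two coefficients vanish and this power is the
    whole ratio; \<open>k = 11\<close> is the last value at which it suffices.\<close>
  then have "(1 - 1 / real k) ^ (k - 1) \<ge> 963/2500"
    by (elim insertE emptyE) (simp_all add: eval_nat_numeral)
  then show ?thesis using assms
    by (intro exI[of _ 0]) (simp add: greedy_opt_coeff_def greedy_inter_coeff_def greedy_union_coeff_def)
next
  case False
  \<comment> \<open>Rounding down costs at most \<open>4 / (5 * k)\<close>, so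
    \<open>k \<ge> 12\<close> puts \<open>h / k\<close> between \<open>1/3\<close> and
    \<open>2/5\<close>, the range of \<open>limit_ratio_lower\<close>.\<close>
  define h where "h = 2 * k div 5"
  define q s where "q = 1 - 1 / real k" and "s = real h / real k"
  have k: "k \<ge> 12" using False by simp
  have h: "h < k" "2 * h \<le> k" using k unfolding h_def by auto
  have "5 * h \<le> 2 * k" "2 * k \<le> 5 * h + 4" unfolding h_def by linarith+
  then have "5 * real h \<le> 2 * real k" "2 * real k \<le> 5 * real h + 4" by linarith+
  then have s: "1/3 \<le> s" "s \<le> 2/5" using k by (auto simp: s_def field_simps)
  have kk: "1 / real k \<le> 1/12" "1 / real k > 0" using k by (auto simp: field_simps)
  have q: "0 \<le> q" "q \<le> 1" using kk by (auto simp: q_def)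
  let ?r = "963/2500 :: real"
  have A: "q ^ (k - h - 1) * ((1 - 2 * ?r) * q + (1 - ?r) * (1 - s))
     \<ge> exp (s - 1) * (1 + 1 / (2 * real k)) * ((1 - 2 * ?r) * q + (1 - ?r) * (1 - s))"
  proof (rule mult_right_mono)
    show "exp (s - 1) * (1 + 1 / (2 * real k)) \<le> q ^ (k - h - 1)"
      unfolding q_def using k h by (intro geometric_lower) (auto simp: s_def)
    show "0 \<le> (1 - 2 * ?r) * q + (1 - ?r) * (1 - s)" using q s by simp
  qed
  \<comment> \<open>The surplus factor outweighs the replacement of \<open>1\<close> by
    \<open>q = 1 - 1 / k\<close>, so the bound for finite \<open>k\<close> is no worse than the
    limit.\<close>
  have "(1 + 1 / (2 * real k)) * ((1 - 2 * ?r) * q + (1 - ?r) * (1 - s))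
     \<ge> (1 - 2 * ?r) + (1 - ?r) * (1 - s)"
  proof -
    define z where "z = 1 / real k"
    have z: "0 < z" "z \<le> 1/12" using kk by (auto simp: z_def)
    have "(1 + z / 2) * ((1 - 2 * ?r) * (1 - z) + (1 - ?r) * (1 - s)) - ((1 - 2 * ?r) + (1 - ?r) * (1 - s))
       = z * ((1 - ?r) * (1 - s) / 2 - (1 - 2 * ?r) / 2 - (1 - 2 * ?r) * z / 2)"
      by (simp add: field_simps)
    also have "\<dots> \<ge> 0" using z s by (intro mult_nonneg_nonneg) (auto simp: field_simps)
    finally have "(1 + z / 2) * ((1 - 2 * ?r) * (1 - z) + (1 - ?r) * (1 - s))
        \<ge> (1 - 2 * ?r) + (1 - ?r) * (1 - s)" by linarith
    moreover have "1 / (2 * real k) = z / 2" "q = 1 - z" by (simp_all add: z_def q_def)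
    ultimately show ?thesis by presburger
  qed
  then have "exp (s - 1) * ((1 + 1 / (2 * real k)) * ((1 - 2 * ?r) * q + (1 - ?r) * (1 - s)))
     \<ge> exp (s - 1) * ((1 - 2 * ?r) + (1 - ?r) * (1 - s))"
    by (rule mult_left_mono) simp
  then have "exp (s - 1) * ((1 - 2 * ?r) + (1 - ?r) * (1 - s))
      \<le> q ^ (k - h - 1) * ((1 - 2 * ?r) * q + (1 - ?r) * (1 - s))"
    using A unfolding mult.assoc by (rule order_trans)
  moreover have "q ^ (k - 1) * (?r - (1 - 2 * ?r) * q) \<ge> exp (- 1) * (389/2500)"
  proof (rule mult_mono)
    have "exp (-1) * (1 + 1 / (2 * real k)) \<le> q ^ (k - 1)"
      unfolding q_def using geometric_lower[of k "k - 1" 0] k by simp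
    moreover have "exp (-1) * 1 \<le> exp (-1 :: real) * (1 + 1 / (2 * real k))"
      by (intro mult_left_mono) auto
    ultimately show "exp (- 1) \<le> q ^ (k - 1)" by linarith
    show "389/2500 \<le> ?r - (1 - 2 * ?r) * q" using q by simp
  qed (use q in auto)
  moreover have "exp (s - 1) * ((1 - 2 * ?r) + (1 - ?r) * (1 - s)) + exp (-1) * (389/2500) \<ge> ?r"
    using limit_ratio_lower[OF s] by simp
  ultimately have "greedy_opt_coeff k h - ?r * (1 + greedy_inter_coeff k h + greedy_union_coeff k h) \<ge> 0"
    unfolding ratio_identity[OF h(1) q_def s_def] by linarith
  then show ?thesis using h by auto
qed

section \<open>The algorithm\<close>

context
  fixes p :: "'w pmf" and step :: "'s \<Rightarrow> 'w \<Rightarrow> 's" and I :: "'s \<Rightarrow> bool"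
  assumes fin: "finite (set_pmf p)"
    and inv: "\<And>s w. I s \<Longrightarrow> w \<in> set_pmf p \<Longrightarrow> I (step s w)"
begin

lemma foldl_expect_geometric:
  fixes psi :: "'s \<Rightarrow> real"
  assumes "0 \<le> q" "\<And>s. I s \<Longrightarrow> q * psi s \<le> expect p (\<lambda>w. psi (step s w))" "I s"
  shows "q ^ n * psi s \<le> expect (replicate_pmf n p) (\<lambda>ws. psi (foldl step s ws))"
  using assms(3)
proof (induction n arbitrary: s)
  case (Suc n)
  have "q ^ Suc n * psi s = q ^ n * (q * psi s)" by simp
  also have "\<dots> \<le> q ^ n * expect p (\<lambda>w. psi (step s w))"
    using assms Suc.prems by (intro mult_left_mono) auto
  also have "\<dots> = expect p (\<lambda>w. q ^ n * psi (step s w))" by simp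
  also have "\<dots> \<le> expect p (\<lambda>w. expect (replicate_pmf n p) (\<lambda>ws. psi (foldl step (step s w) ws)))"
    using Suc inv by (intro expect_mono fin) auto
  finally show ?case by (simp add: expect_replicate_Suc[OF fin] del: replicate_pmf.simps)
qed simp

text \<open>Solution of a linear recursion: \<open>phi\<close> moves towards \<open>psi + d\<close>
  at rate \<open>1 / k\<close> while \<open>psi\<close> decays by \<open>q\<close>. The truncated
  \<open>n - 1\<close> at \<open>n = 0\<close> is harmless because of the factor
  \<open>real n\<close>.\<close>

lemma foldl_expect_coupled:
  fixes phi psi :: "'s \<Rightarrow> real" and k :: nat
  assumes k: "k > 0" and q: "q = 1 - 1 / real k"
    and phi: "\<And>s. I s \<Longrightarrow> q * phi s + (psi s + d) / k \<le> expect p (\<lambda>w. phi (step s w))"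
    and psi: "\<And>s. I s \<Longrightarrow> q * psi s \<le> expect p (\<lambda>w. psi (step s w))"
    and "I s"
  shows "q ^ n * phi s + real n / k * q ^ (n - 1) * psi s + (1 - q ^ n) * d
     \<le> expect (replicate_pmf n p) (\<lambda>ws. phi (foldl step s ws))"
  using \<open>I s\<close>
proof (induction n arbitrary: s)
  case (Suc n)
  let ?c = "real n / k * q ^ (n - 1)"
  have q0: "0 \<le> q" "q \<le> 1" using k q by simp_all
  have c: "0 \<le> ?c" using q0 by simp
  have cq: "?c * q = real n / k * q ^ n" by (cases n) auto
  have "q ^ Suc n * phi s + real (Suc n) / k * q ^ (Suc n - 1) * psi s + (1 - q ^ Suc n) * d
      = q ^ n * (q * phi s + (psi s + d) / k) + real n / k * q ^ n * psi s + (1 - q ^ n) * d"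
    unfolding q using k by (simp add: field_simps)
  also have "\<dots> = q ^ n * (q * phi s + (psi s + d) / k) + ?c * (q * psi s) + (1 - q ^ n) * d"
    unfolding cq[symmetric] by simp
  also have "\<dots> \<le> q ^ n * expect p (\<lambda>w. phi (step s w)) + ?c * expect p (\<lambda>w. psi (step s w)) + (1 - q ^ n) * d"
    using phi psi Suc.prems q0 c by (intro add_mono mult_left_mono order_refl) auto
  also have "\<dots> = expect p (\<lambda>w. q ^ n * phi (step s w) + ?c * psi (step s w) + (1 - q ^ n) * d)"
    by (simp add: expect_add[OF fin])
  also have "\<dots> \<le> expect p (\<lambda>w. expect (replicate_pmf n p) (\<lambda>ws. phi (foldl step (step s w) ws)))"
    using Suc inv by (intro expect_mono fin) auto
  finally show ?case by (simp add: expect_replicate_Suc[OF fin] del: replicate_pmf.simps)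
qed simp

text \<open>The expected increments of \<open>phi\<close> telescope and cannot exceed
  \<open>U - phi s\<close>. Hence \<open>Phi\<close> is small on average at a uniformly random
  stopping time.\<close>

lemma foldl_expect_sum_le:
  fixes phi Phi :: "'s \<Rightarrow> real"
  assumes "\<And>s. I s \<Longrightarrow> phi s \<le> U" "0 \<le> K"
    and gain: "\<And>s. I s \<Longrightarrow> Phi s \<le> K * (expect p (\<lambda>w. phi (step s w)) - phi s)"
    and "I s"
  shows "(\<Sum>i<n. expect (replicate_pmf i p) (\<lambda>ws. Phi (foldl step s ws))) \<le> K * (U - phi s)"
  using \<open>I s\<close>
proof (induction n arbitrary: s)
  case 0
  then show ?case using assms by simp
next
  case (Suc n)
  let ?E = "\<lambda>i s. expect (replicate_pmf i p) (\<lambda>ws. Phi (foldl step s ws))"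
  have "(\<Sum>i<Suc n. ?E i s) = Phi s + (\<Sum>i<n. ?E (Suc i) s)"
    unfolding sum.lessThan_Suc_shift by simp
  also have "(\<Sum>i<n. ?E (Suc i) s) = expect p (\<lambda>w. \<Sum>i<n. ?E i (step s w))"
    by (simp add: expect_replicate_Suc[OF fin] Bochner_Integration.integral_sum
        integrable_measure_pmf_finite[OF fin] del: replicate_pmf.simps)
  also have "\<dots> \<le> expect p (\<lambda>w. K * (U - phi (step s w)))"
    using Suc inv by (intro expect_mono fin) auto
  also have "\<dots> = K * (U - expect p (\<lambda>w. phi (step s w)))"
    by (simp add: expect_diff[OF fin])
  finally show ?case using gain[OF Suc.prems] by (simp add: algebra_simps)
qed

end

section \<open>Expected outcome of guided greedy and of local search\<close>

context submodular_instance
begin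

abbreviation "greedy P \<equiv> foldl (\<lambda>S s. greedy_step P S s f)"
abbreviation "local_search \<equiv> foldl (\<lambda>S s. swap_step N k S s f)"

text \<open>While \<open>Z\<close> is barred, the solution stays disjoint from \<open>Z\<close>, so
  its union with \<open>Q\<close> keeps a value of at least \<open>f Q - f (Z \<union> Q)\<close>.
  The price is that only \<open>Q - Z\<close> can be collected, which costs at most
  \<open>f (Z \<inter> Q)\<close>. After the bar is lifted, the usual analysis continues from the
  values reached.\<close>

lemma guided_greedy_expect:
  assumes Z: "Z \<subseteq> N" and Q: "Q \<subseteq> N" "card Q \<le> k" "f Q = opt" and h: "h < k"
  shows "greedy_opt_coeff k h * opt - greedy_inter_coeff k h * f (Z \<inter> Q)
      - greedy_union_coeff k h * f (Z \<union> Q) - e * opt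
    \<le> expect (replicate_pmf h D) (\<lambda>g. expect (replicate_pmf (k - h) D)
         (\<lambda>g'. f (greedy N (greedy (N - Z) {} g) g')))"
proof -
  define q where "q = 1 - 1 / real k"
  define m where "m = k - h"
  define uni int where "uni = f (Z \<union> Q)" and "int = f (Z \<inter> Q)"
  have q0: "0 \<le> q" "q \<le> 1" using k_pos by (auto simp: q_def)
  have m0: "m > 0" "real m = real k - real h" using h by (auto simp: m_def of_nat_diff)
  let ?I = "\<lambda>S. S \<subseteq> N - Z"
  let ?st = "\<lambda>S s. greedy_step (N - Z) S s f"
  have inv1: "?I (?st S s)" if "?I S" for S s
    using greedy_step_subset[of "N - Z" S s] that by auto
  have lower: "0 \<le> f (S \<union> Q \<union> V) + (uni - opt)" if "?I S" "V \<subseteq> N - Z" for S V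
  proof -
    have "f ((S \<union> Q \<union> V) \<union> (Z \<union> Q)) + f ((S \<union> Q \<union> V) \<inter> (Z \<union> Q)) \<le> f (S \<union> Q \<union> V) + f (Z \<union> Q)"
      using that Z Q by (intro lattice) auto
    moreover have "(S \<union> Q \<union> V) \<inter> (Z \<union> Q) = Q" using that by auto
    moreover have "0 \<le> f ((S \<union> Q \<union> V) \<union> (Z \<union> Q))" using that Z Q by (intro nonnegD) auto
    ultimately show ?thesis using Q by (simp add: uni_def)
  qed
  \<comment> \<open>The shift makes \<open>psi\<close> nonnegative during the first phase, which is
    what its decay by \<open>q\<close> rests on.\<close>
  define psi where "psi S = f (S \<union> Q) + (uni - opt)" for S
  have psi_step: "q * psi S \<le> expect D (\<lambda>s. psi (?st S s))" if "?I S" for S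
    unfolding psi_def q_def using that Q lower by (intro greedy_step_expect_union) auto
  have phi_step: "q * f S + (psi S + (opt - uni - int - e * opt)) / k
      \<le> expect D (\<lambda>s. f (?st S s))" if S: "?I S" for S
  proof -
    have "f ((S \<union> (Q \<inter> (N - Z))) \<union> (Z \<inter> Q)) + f ((S \<union> (Q \<inter> (N - Z))) \<inter> (Z \<inter> Q))
        \<le> f (S \<union> (Q \<inter> (N - Z))) + f (Z \<inter> Q)"
      using S Z Q by (intro lattice) auto
    moreover have "(S \<union> (Q \<inter> (N - Z))) \<union> (Z \<inter> Q) = S \<union> Q" "(S \<union> (Q \<inter> (N - Z))) \<inter> (Z \<inter> Q) = {}"
      using S Q by auto
    ultimately have "psi S + (opt - uni - int) \<le> f (S \<union> (Q \<inter> (N - Z)))"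
      using nonnegD[of "{}"] by (simp add: psi_def int_def)
    then have "(psi S + (opt - uni - int - e * opt)) / k \<le> (f (S \<union> (Q \<inter> (N - Z))) - e * opt) / k"
      by (intro divide_right_mono) auto
    moreover have "(1 - 1 / k) * f S + (f (S \<union> (Q \<inter> (N - Z))) - e * opt) / k \<le> expect D (\<lambda>s. f (?st S s))"
      using S Q by (intro greedy_step_expect_value) auto
    ultimately show ?thesis by (simp add: q_def)
  qed
  have psi0: "psi {} = uni" using Q by (simp add: psi_def)
  let ?E1 = "expect (replicate_pmf h D)"
  have psi_h: "q ^ h * uni \<le> ?E1 (\<lambda>g. psi (greedy (N - Z) {} g))"
    using foldl_expect_geometric[where psi = psi and I = ?I and s = "{}" and step = ?st, OF finite_D inv1 q0(1) psi_step]
    unfolding psi0 by simp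
  have phi_h: "q ^ h * f {} + real h / k * q ^ (h - 1) * uni + (1 - q ^ h) * (opt - uni - int - e * opt)
      \<le> ?E1 (\<lambda>g. f (greedy (N - Z) {} g))"
    using foldl_expect_coupled[where phi = f and psi = psi and I = ?I and s = "{}" and step = ?st
        and n = h and d = "opt - uni - int - e * opt", OF finite_D inv1 k_pos q_def phi_step psi_step]
    unfolding psi0 by simp
  \<comment> \<open>Without the bar the union potential needs no shift, and the drift
    \<open>d\<close> is only the sampling error.\<close>
  have second: "q ^ m * f S + real m / k * q ^ (m - 1) * f (S \<union> Q) + (1 - q ^ m) * (- e * opt)
      \<le> expect (replicate_pmf m D) (\<lambda>g'. f (greedy N S g'))" if "S \<subseteq> N" for S
  proof (rule foldl_expect_coupled[where I = "\<lambda>S. S \<subseteq> N" and psi = "\<lambda>S. f (S \<union> Q)", OF finite_D _ k_pos q_def _ _ that])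
    fix S assume S: "S \<subseteq> N"
    show "greedy_step N S s f \<subseteq> N" for s using greedy_step_subset[of N S s] S by auto
    have "Q \<inter> N = Q" using Q by auto
    then show "q * f S + (f (S \<union> Q) + - e * opt) / k \<le> expect D (\<lambda>s. f (greedy_step N S s f))"
      using greedy_step_expect_value[OF order_refl S Q(1,2)] by (simp add: q_def)
    show "q * f (S \<union> Q) \<le> expect D (\<lambda>s. f (greedy_step N S s f \<union> Q))"
      using greedy_step_expect_union[OF order_refl S Q(1), of 0] S Q nonnegD by (simp add: q_def)
  qed
  have fR: "finite (set_pmf (replicate_pmf h D))" using finite_D by (rule finite_set_replicate_pmf)
  have sub: "greedy (N - Z) S g \<subseteq> N - Z" if "?I S" for S g
    using that by (induction g arbitrary: S) (auto simp: inv1)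
  let ?c = "real m / k * q ^ (m - 1)"
  have c: "0 \<le> ?c" using q0 by simp
  have "q ^ m * (q ^ h * f {} + real h / k * q ^ (h - 1) * uni + (1 - q ^ h) * (opt - uni - int - e * opt))
      + ?c * (q ^ h * uni - (uni - opt)) + (1 - q ^ m) * (- e * opt)
      \<le> q ^ m * ?E1 (\<lambda>g. f (greedy (N - Z) {} g))
      + ?c * (?E1 (\<lambda>g. psi (greedy (N - Z) {} g)) - (uni - opt)) + (1 - q ^ m) * (- e * opt)"
    using phi_h psi_h q0 c by (intro add_mono mult_left_mono diff_mono order_refl) auto
  also have "\<dots> = ?E1 (\<lambda>g. q ^ m * f (greedy (N - Z) {} g) + ?c * (psi (greedy (N - Z) {} g) - (uni - opt))
      + (1 - q ^ m) * (- e * opt))"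
    by (simp add: expect_add[OF fR] expect_diff[OF fR])
  also have "\<dots> \<le> ?E1 (\<lambda>g. expect (replicate_pmf m D) (\<lambda>g'. f (greedy N (greedy (N - Z) {} g) g')))"
  proof (rule expect_mono[OF fR])
    fix g
    have "greedy (N - Z) {} g \<subseteq> N" using sub[of "{}" g] by auto
    from second[OF this] show "q ^ m * f (greedy (N - Z) {} g) + ?c * (psi (greedy (N - Z) {} g) - (uni - opt))
      + (1 - q ^ m) * (- e * opt) \<le> expect (replicate_pmf m D) (\<lambda>g'. f (greedy N (greedy (N - Z) {} g) g'))"
      by (simp add: psi_def)
  qed
  finally have main: "q ^ m * (q ^ h * f {} + real h / k * q ^ (h - 1) * uni + (1 - q ^ h) * (opt - uni - int - e * opt))
      + ?c * (q ^ h * uni - (uni - opt)) + (1 - q ^ m) * (- e * opt)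
      \<le> ?E1 (\<lambda>g. expect (replicate_pmf m D) (\<lambda>g'. f (greedy N (greedy (N - Z) {} g) g')))" .
  have p1: "q ^ m * (real h / k * q ^ (h - 1)) = real h / k * q ^ (k - 1)"
  proof (cases h)
    case (Suc h')
    then have "k - 1 = m + (h - 1)" using h by (simp add: m_def)
    then show ?thesis by (simp add: power_add)
  qed simp
  have "q ^ m * (q ^ h * f {} + real h / k * q ^ (h - 1) * uni + (1 - q ^ h) * (opt - uni - int - e * opt))
      + ?c * (q ^ h * uni - (uni - opt)) + (1 - q ^ m) * (- e * opt)
    = greedy_opt_coeff k h * opt - greedy_inter_coeff k h * int - greedy_union_coeff k h * uni - e * opt
      + q ^ m * q ^ h * (f {} + e * opt)"
  proof -
    have eq: "q ^ m * (q ^ h * f {} + real h / k * q ^ (h - 1) * uni + (1 - q ^ h) * (opt - uni - int - e * opt))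
      = q ^ m * q ^ h * f {} + real h / k * q ^ (k - 1) * uni + q ^ m * (1 - q ^ h) * (opt - uni - int - e * opt)"
      unfolding p1[symmetric] by (simp add: distrib_left mult.assoc)
    show ?thesis
      unfolding eq greedy_opt_coeff_def greedy_inter_coeff_def greedy_union_coeff_def Let_def
        q_def[symmetric] m_def[symmetric]
      by (simp add: algebra_simps add_divide_distrib diff_divide_distrib)
  qed
  moreover have "0 \<le> q ^ m * q ^ h * (f {} + e * opt)"
    using q0 e opt_nonneg nonnegD[of "{}"] by simp
  ultimately show ?thesis using main unfolding uni_def int_def m_def by linarith
qed

lemma local_search_feasible:
  "S \<subseteq> N \<Longrightarrow> card S \<le> k \<Longrightarrow> local_search S ls \<subseteq> N \<and> card (local_search S ls) \<le> k"
  by (induction ls arbitrary: S) (auto simp: swap_step_feasible)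

text \<open>The violation is a nonnegative combination, with weights \<open>v - u\<close> and
  \<open>u\<close>, of the two local optimality conditions. By \<open>swap_step_expect\<close> it is
  at most \<open>2 * k\<close> times the expected gain of one step, and the gains total at most
  \<open>opt\<close>; averaging over \<open>L * k\<close> stopping times leaves
  \<open>2 / L * opt\<close>.\<close>

lemma local_search_expect:
  assumes Q: "Q \<subseteq> N" "card Q \<le> k" and coeff: "0 \<le> u" "u \<le> v" "v \<le> 1" and L: "L > 0"
  shows "expect (pmf_of_set {..<L * k} \<bind> (\<lambda>i. replicate_pmf i D))
      (\<lambda>ls. v * f (local_search {} ls \<inter> Q) + u * f (local_search {} ls \<union> Q) - (v + u) * f (local_search {} ls))
     \<le> 2 / L * opt"
proof -
  define Phi where "Phi S = v * f (S \<inter> Q) + u * f (S \<union> Q) - (v + u) * f S" for S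
  let ?I = "\<lambda>S. S \<subseteq> N \<and> card S \<le> k"
  have gain: "Phi S \<le> 2 * real k * (expect D (\<lambda>s. f (swap_step N k S s f)) - f S)" if S: "?I S" for S
  proof -
    let ?g = "expect D (\<lambda>s. f (swap_step N k S s f)) - f S"
    let ?a = "f (S \<inter> Q) - f S" and ?b = "f (S \<union> Q) + f (S \<inter> Q) - 2 * f S"
    note g = swap_step_expect[OF conjunct1[OF S] conjunct2[OF S] Q]
    have kg: "0 \<le> k * ?g" using g(1) by simp
    have "?a \<le> k * ?g" using g(2) k_pos by (simp add: field_simps)
    then have a: "?a \<le> 2 * (k * ?g)" using kg by linarith
    have b: "?b \<le> 2 * (k * ?g)"
    proof (cases "?b \<ge> 0")
      case True
      have "1 / 2 * ?b \<le> (1 - e) * ?b" using True e by (intro mult_right_mono) auto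
      also have "\<dots> \<le> k * ?g" using g(3) k_pos by (simp add: field_simps)
      finally show ?thesis by simp
    qed (use kg in linarith)
    have "Phi S = (v - u) * ?a + u * ?b" by (simp add: Phi_def algebra_simps)
    also have "\<dots> \<le> (v - u) * (2 * (k * ?g)) + u * (2 * (k * ?g))"
      using a b coeff by (intro add_mono mult_left_mono) auto
    also have "\<dots> = v * (2 * (k * ?g))" by (simp add: algebra_simps)
    also have "\<dots> \<le> 2 * (k * ?g)" using coeff kg by (intro mult_left_le_one_le) auto
    finally show ?thesis by simp
  qed
  have "(\<Sum>i<L * k. expect (replicate_pmf i D) (\<lambda>ls. Phi (local_search {} ls))) \<le> 2 * real k * (opt - f {})"
    by (rule foldl_expect_sum_le[where I = ?I and phi = f, OF finite_D])
      (auto simp: swap_step_feasible le_opt intro: gain)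
  also have "\<dots> \<le> 2 * real k * opt" using nonnegD[of "{}"] by (intro mult_left_mono) auto
  finally have sum: "(\<Sum>i<L * k. expect (replicate_pmf i D) (\<lambda>ls. Phi (local_search {} ls))) \<le> 2 * real k * opt" .
  have "expect (pmf_of_set {..<L * k} \<bind> (\<lambda>i. replicate_pmf i D)) (\<lambda>ls. Phi (local_search {} ls))
      = (\<Sum>i<L * k. expect (replicate_pmf i D) (\<lambda>ls. Phi (local_search {} ls))) / real (L * k)"
    using L k_pos finite_set_replicate_pmf[OF finite_D]
    by (subst expect_bind) (auto simp: integral_pmf_of_set lessThan_empty_iff)
  also have "\<dots> \<le> 2 * real k * opt / real (L * k)" using sum by (rule divide_right_mono) simp
  also have "\<dots> = 2 / L * opt" using k_pos by simp
  finally show ?thesis unfolding Phi_def .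
qed

end

section \<open>The randomized query tree, its cost and its value\<close>

definition algorithm_tree ::
    "'a set \<Rightarrow> nat \<Rightarrow> ('a option list \<times> nat) list \<Rightarrow> bool \<Rightarrow> ('a option list \<times> nat) list \<Rightarrow>
     ('a option list \<times> nat) list \<Rightarrow> 'a qtree" where
  "algorithm_tree N k ls coin g g' =
     loop (swap_queries N) (swap_step N k) ls {} (\<lambda>Z.
       if coin then
         loop (greedy_queries (N - Z)) (greedy_step (N - Z)) g {} (\<lambda>S.
           loop (greedy_queries N) (greedy_step N) g' S Output)
       else Output Z)"

text \<open>All random bits are drawn in advance, independently of \<open>f\<close>, so each outcome
  is a deterministic tree. With this \<open>p\<close>, the probability of returning the local search
  set is \<open>p\<close> times the sum of the two negative coefficients.\<close>

definition algorithm :: "nat \<Rightarrow> nat \<Rightarrow> nat \<Rightarrow> (nat \<Rightarrow> nat) \<Rightarrow> 'a set \<Rightarrow> nat \<Rightarrow> 'a qtree pmf" where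
  "algorithm a b L h N k =
     (let D = sample_pmf N k a b;
          p = 1 / (1 + greedy_inter_coeff k (h k) + greedy_union_coeff k (h k))
      in pmf_of_set {..<L * k} \<bind> (\<lambda>i. replicate_pmf i D) \<bind> (\<lambda>ls.
         bernoulli_pmf p \<bind> (\<lambda>coin.
         replicate_pmf (h k) D \<bind> (\<lambda>g.
         replicate_pmf (k - h k) D \<bind> (\<lambda>g'.
         return_pmf (algorithm_tree N k ls coin g g'))))))"

context submodular_instance
begin

lemma valid_seed:
  assumes "s \<in> set_pmf D"
  shows "length (fst s) = a * blocks N k" "snd s < length (fst s)"
proof -
  show len: "length (fst s) = a * blocks N k" using set_sample_pmf[OF k_pos ab(1) assms] by simp
  have "a * 2 \<le> a * blocks N k" by (simp add: blocks_def)
  then show "snd s < length (fst s)" using set_sample_pmf[OF k_pos ab(1) assms] ab by linarith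
qed

lemma greedy_loop:
  assumes "P \<subseteq> N" "S \<subseteq> N" "set g \<subseteq> set_pmf D"
  shows "greedy P S g \<subseteq> N"
    "run (loop (greedy_queries P) (greedy_step P) g S c) f = run (c (greedy P S g)) f"
    "num_queries (loop (greedy_queries P) (greedy_step P) g S c) f
       \<le> (1 + a * blocks N k) * length g + num_queries (c (greedy P S g)) f"
proof -
  have "greedy_step P S s f \<subseteq> N" if "S \<subseteq> N" for S s
    using greedy_step_subset[of P S s] assms(1) that by auto
  moreover have "greedy_step P S s (override_on (\<lambda>_. 0) f (set (greedy_queries P S s))) = greedy_step P S s f"
    if "s \<in> set_pmf D" for S s
    using valid_seed[OF that] by (intro greedy_step_local) auto
  moreover have "length (greedy_queries P S s) \<le> 1 + a * blocks N k" if "s \<in> set_pmf D" for S s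
    using valid_seed[OF that] by (simp add: greedy_queries_def)
  ultimately show "greedy P S g \<subseteq> N"
    "run (loop (greedy_queries P) (greedy_step P) g S c) f = run (c (greedy P S g)) f"
    "num_queries (loop (greedy_queries P) (greedy_step P) g S c) f
       \<le> (1 + a * blocks N k) * length g + num_queries (c (greedy P S g)) f"
    using loop_correct[where I = "\<lambda>S. S \<subseteq> N" and W = "set_pmf D" and B = "1 + a * blocks N k"
        and qs = "greedy_queries P" and st = "greedy_step P" and f = f, OF assms(2,3)] by auto
qed

lemma local_search_loop:
  assumes "set ls \<subseteq> set_pmf D"
  shows "run (loop (swap_queries N) (swap_step N k) ls {} c) f = run (c (local_search {} ls)) f"
    "num_queries (loop (swap_queries N) (swap_step N k) ls {} c) f
       \<le> (1 + a * blocks N k + k) * length ls + num_queries (c (local_search {} ls)) f"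
proof -
  let ?I = "\<lambda>S. S \<subseteq> N \<and> card S \<le> k"
  have "?I (swap_step N k S s f)" if "?I S" for S s
    using that swap_step_feasible by auto
  moreover have "swap_step N k S s (override_on (\<lambda>_. 0) f (set (swap_queries N S s))) = swap_step N k S s f"
    if "?I S" "s \<in> set_pmf D" for S s
    using valid_seed[OF that(2)] that(1) finite_subset_N k_pos by (intro swap_step_local) auto
  moreover have "length (swap_queries N S s) \<le> 1 + a * blocks N k + k" if "?I S" "s \<in> set_pmf D" for S s
    using valid_seed[OF that(2)] that(1) finite_subset_N by (simp add: swap_queries(2))
  ultimately show "run (loop (swap_queries N) (swap_step N k) ls {} c) f = run (c (local_search {} ls)) f"
    "num_queries (loop (swap_queries N) (swap_step N k) ls {} c) f
       \<le> (1 + a * blocks N k + k) * length ls + num_queries (c (local_search {} ls)) f"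
    using loop_correct[where I = ?I and W = "set_pmf D" and B = "1 + a * blocks N k + k" and s = "{}"
        and qs = "swap_queries N" and st = "swap_step N k" and f = f, OF _ assms] by auto
qed

lemma card_greedy: "S \<subseteq> N \<Longrightarrow> P \<subseteq> N \<Longrightarrow> card (greedy P S g) \<le> card S + length g"
proof (induction g arbitrary: S)
  case (Cons s g)
  have "greedy_step P S s f \<subseteq> N" using greedy_step_subset[of P S s] Cons.prems by auto
  moreover have "card (greedy_step P S s f) \<le> Suc (card S)"
    by (auto simp: greedy_step_def Let_def add_elem_def card_insert_le_m1 split: option.splits
        intro: card_insert_le order.trans[OF card_insert_le_m1])
  ultimately show ?case using Cons.IH[of "greedy_step P S s f"] Cons.prems by simp
qed simp

lemma algorithm_tree:
  fixes coin :: bool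
  assumes "set ls \<subseteq> set_pmf D" "set g \<subseteq> set_pmf D" "set g' \<subseteq> set_pmf D"
    and "length ls \<le> L * k" "length g + length g' \<le> k"
  defines "t \<equiv> algorithm_tree N k ls coin g g'"
  defines "Z \<equiv> local_search {} ls"
  shows "run t f = (if coin then greedy N (greedy (N - Z) {} g) g' else Z)"
    "run t f \<subseteq> N" "card (run t f) \<le> k"
    "num_queries t f \<le> (1 + a * blocks N k + k) * (L * k) + (1 + a * blocks N k) * k"
proof -
  have Z: "Z \<subseteq> N" "card Z \<le> k" using local_search_feasible[of "{}" ls] by (auto simp: Z_def)
  let ?S = "greedy (N - Z) {} g"
  have S: "?S \<subseteq> N" by (rule greedy_loop(1)) (use assms in auto)
  have S': "greedy N ?S g' \<subseteq> N" by (rule greedy_loop(1)) (use assms S in auto)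
  have NZ: "N - Z \<subseteq> N" by auto
  note greedy1 = greedy_loop(2,3)[OF NZ empty_subsetI assms(2)]
  note greedy2 = greedy_loop(2,3)[OF order_refl S assms(3)]
  show r: "run t f = (if coin then greedy N ?S g' else Z)"
    unfolding t_def algorithm_tree_def
    by (simp add: local_search_loop(1)[OF assms(1)] greedy1(1) greedy2(1) flip: Z_def)
  have "card (greedy N ?S g') \<le> card ?S + length g'" using S by (intro card_greedy) auto
  also have "card ?S \<le> length g" using card_greedy[of "{}" "N - Z" g] by auto
  finally have "card (greedy N ?S g') \<le> k" using assms(5) by simp
  then show "run t f \<subseteq> N" "card (run t f) \<le> k" using r S' Z by auto
  let ?c = "\<lambda>Z. if coin then loop (greedy_queries (N - Z)) (greedy_step (N - Z)) g {} (\<lambda>S.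
           loop (greedy_queries N) (greedy_step N) g' S Output) else Output Z"
  have "num_queries (?c Z) f \<le> (1 + a * blocks N k) * (length g + length g')"
    using greedy1(2)[where c = "\<lambda>S. loop (greedy_queries N) (greedy_step N) g' S Output"]
      greedy2(2)[where c = Output] by (auto simp: distrib_left)
  also have "\<dots> \<le> (1 + a * blocks N k) * k" using assms(5) by (rule mult_le_mono2)
  finally have "num_queries (?c Z) f \<le> (1 + a * blocks N k) * k" .
  moreover have "num_queries t f \<le> (1 + a * blocks N k + k) * length ls + num_queries (?c Z) f"
    unfolding t_def algorithm_tree_def Z_def by (rule local_search_loop(2)[OF assms(1)])
  moreover have "(1 + a * blocks N k + k) * length ls \<le> (1 + a * blocks N k + k) * (L * k)"
    using assms(4) by (rule mult_le_mono2)
  ultimately show "num_queries t f \<le> (1 + a * blocks N k + k) * (L * k) + (1 + a * blocks N k) * k"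
    by linarith
qed

text \<open>\<open>k * blocks N k\<close> is at most \<open>2 * card N + 2 * k\<close>, and
  \<open>k \<le> k ^ 2\<close> absorbs the linear terms.\<close>

lemma query_bound:
  "real ((1 + a * blocks N k + k) * (L * k) + (1 + a * blocks N k) * k)
     \<le> real ((L + 1) * (2 * a + 2)) * (real (card N) + real k ^ 2)"
proof -
  have kk: "k \<le> k ^ 2" using k_pos by (simp add: power2_eq_square)
  have "blocks N k * k = 2 * (card N div k * k) + 2 * k" by (simp add: blocks_def algebra_simps)
  also have "\<dots> \<le> 2 * card N + 2 * k ^ 2" using kk by (intro add_mono mult_le_mono2) auto
  finally have "a * (blocks N k * k) \<le> a * (2 * card N + 2 * k ^ 2)" by (rule mult_le_mono2)
  then have *: "(1 + a * blocks N k + k) * k \<le> (2 * a + 2) * (card N + k ^ 2)"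
  proof -
    have "(1 + a * blocks N k + k) * k = k + a * (blocks N k * k) + k ^ 2"
      by (simp add: algebra_simps power2_eq_square)
    moreover have "(2 * a + 2) * (card N + k ^ 2) = a * (2 * card N + 2 * k ^ 2) + 2 * card N + 2 * k ^ 2"
      by (simp add: algebra_simps)
    ultimately show ?thesis using kk \<open>a * (blocks N k * k) \<le> _\<close> by linarith
  qed
  have "(1 + a * blocks N k + k) * (L * k) + (1 + a * blocks N k) * k
      \<le> (L + 1) * ((1 + a * blocks N k + k) * k)" by (simp add: algebra_simps)
  also have "\<dots> \<le> (L + 1) * ((2 * a + 2) * (card N + k ^ 2))" using * by (rule mult_le_mono2)
  finally have "(1 + a * blocks N k + k) * (L * k) + (1 + a * blocks N k) * k
      \<le> (L + 1) * (2 * a + 2) * (card N + k ^ 2)" by (simp only: mult.assoc)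
  then show ?thesis by (metis of_nat_add of_nat_le_iff of_nat_mult of_nat_power)
qed

lemma algorithm_support:
  assumes "L > 0" "h k < k" "t \<in> set_pmf (algorithm a b L h N k)"
  shows "run t f \<subseteq> N" "card (run t f) \<le> k"
    "real (num_queries t f) \<le> real ((L + 1) * (2 * a + 2)) * (real (card N) + real k ^ 2)"
proof -
  have ne: "finite {..<L * k}" "{..<L * k} \<noteq> {}" using assms(1) k_pos by (auto simp: lessThan_empty_iff)
  obtain i ls coin g g' where t: "t = algorithm_tree N k ls coin g g'" and i: "i < L * k"
    and seeds: "ls \<in> set_pmf (replicate_pmf i D)" "g \<in> set_pmf (replicate_pmf (h k) D)"
      "g' \<in> set_pmf (replicate_pmf (k - h k) D)"
    using assms(3) unfolding algorithm_def Let_def by (auto simp: set_pmf_of_set[OF ne(2,1)])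
  have "set ls \<subseteq> set_pmf D" "set g \<subseteq> set_pmf D" "set g' \<subseteq> set_pmf D"
    "length ls \<le> L * k" "length g + length g' \<le> k"
    using seeds i assms(2) by (auto simp: set_replicate_pmf)
  note tree = algorithm_tree(2-4)[OF this]
  show "run t f \<subseteq> N" "card (run t f) \<le> k"
    "real (num_queries t f) \<le> real ((L + 1) * (2 * a + 2)) * (real (card N) + real k ^ 2)"
    unfolding t using tree(1,2) order_trans[OF of_nat_mono[OF tree(3)] query_bound] by auto
qed

text \<open>The identity \<open>1 - p = p * (be + ga)\<close> supplies exactly the multiple of
  \<open>f Z\<close> that completes the negative terms of the greedy bound to the local search
  violation, which is small in expectation.\<close>

lemma algorithm_expect:
  assumes "L > 0" and h: "h k < k" "2 * h k \<le> k"
    and ratio: "r * (1 + greedy_inter_coeff k (h k) + greedy_union_coeff k (h k)) \<le> greedy_opt_coeff k (h k)"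
  shows "(r - e - 2 / L) * opt \<le> expect (algorithm a b L h N k) (\<lambda>t. f (run t f))"
proof -
  define al be ga where "al = greedy_opt_coeff k (h k)" and "be = greedy_inter_coeff k (h k)"
    and "ga = greedy_union_coeff k (h k)"
  define p where "p = 1 / (1 + be + ga)"
  have c: "0 \<le> be" "be \<le> 1" "ga \<le> be" "0 \<le> ga"
    using coeff_properties[OF h(1)] h(2) by (auto simp: be_def ga_def)
  have p: "0 \<le> p" "p \<le> 1" "p * (1 + be + ga) = 1" using c by (auto simp: p_def)
  have ne: "finite {..<L * k}" "{..<L * k} \<noteq> {}" using assms(1) k_pos by (auto simp: lessThan_empty_iff)
  obtain Q where Q: "Q \<subseteq> N" "card Q \<le> k" "f Q = opt" using opt_attained by blast
  let ?R = "\<lambda>n. replicate_pmf n D"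
  let ?X = "pmf_of_set {..<L * k} \<bind> ?R"
  have fR: "finite (set_pmf (?R n))" for n using finite_D by (rule finite_set_replicate_pmf)
  have fX: "finite (set_pmf ?X)" using fR ne by auto
  let ?Z = "local_search {}"
  have inner: "expect (?R (h k)) (\<lambda>g. expect (?R (k - h k)) (\<lambda>g'. f (run (algorithm_tree N k ls coin g g') f)))
    = (if coin then expect (?R (h k)) (\<lambda>g. expect (?R (k - h k))
          (\<lambda>g'. f (greedy N (greedy (N - ?Z ls) {} g) g'))) else f (?Z ls))"
    if ls: "ls \<in> set_pmf ?X" for ls coin
  proof -
    have "set ls \<subseteq> set_pmf D" "length ls \<le> L * k"
      using ls ne by (auto simp: set_replicate_pmf)
    then have "f (run (algorithm_tree N k ls coin g g') f)
      = (if coin then f (greedy N (greedy (N - ?Z ls) {} g) g') else f (?Z ls))"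
      if "g \<in> set_pmf (?R (h k))" "g' \<in> set_pmf (?R (k - h k))" for g g'
      using that h(1) by (subst algorithm_tree(1)[where L = L]) (auto simp: set_replicate_pmf)
    then have "expect (?R (h k)) (\<lambda>g. expect (?R (k - h k)) (\<lambda>g'. f (run (algorithm_tree N k ls coin g g') f)))
      = expect (?R (h k)) (\<lambda>g. expect (?R (k - h k))
          (\<lambda>g'. if coin then f (greedy N (greedy (N - ?Z ls) {} g) g') else f (?Z ls)))"
      by (intro expect_cong)
    then show ?thesis by (cases coin) simp_all
  qed
  define T where "T ls coin = ?R (h k) \<bind> (\<lambda>g. ?R (k - h k) \<bind> (\<lambda>g'.
    return_pmf (algorithm_tree N k ls coin g g')))" for ls coin
  have fT: "finite (set_pmf (T ls coin))" for ls coin using fR by (simp add: T_def)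
  have ET: "expect (T ls coin) F = expect (?R (h k)) (\<lambda>g. expect (?R (k - h k))
      (\<lambda>g'. F (algorithm_tree N k ls coin g g')))" for ls coin F
    unfolding T_def using fR by (simp add: expect_bind)
  have "algorithm a b L h N k = ?X \<bind> (\<lambda>ls. bernoulli_pmf p \<bind> T ls)"
    unfolding algorithm_def Let_def be_def ga_def p_def T_def ..
  then have "expect (algorithm a b L h N k) (\<lambda>t. f (run t f))
     = expect ?X (\<lambda>ls. expect (bernoulli_pmf p \<bind> T ls) (\<lambda>t. f (run t f)))"
    using fT by (simp only: expect_bind[OF fX] set_bind_pmf finite_UN_I finite)
  also have "\<dots> = expect ?X (\<lambda>ls. expect (bernoulli_pmf p) (\<lambda>coin.
         expect (?R (h k)) (\<lambda>g. expect (?R (k - h k)) (\<lambda>g'. f (run (algorithm_tree N k ls coin g g') f)))))"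
    using fT by (simp add: expect_bind ET)
  also have "\<dots> = expect ?X (\<lambda>ls. p * expect (?R (h k)) (\<lambda>g. expect (?R (k - h k))
          (\<lambda>g'. f (greedy N (greedy (N - ?Z ls) {} g) g'))) + (1 - p) * f (?Z ls))"
    using p by (intro expect_cong) (simp add: inner mult.commute)
  also have "\<dots> \<ge> expect ?X (\<lambda>ls. p * (al - e) * opt
      - p * (be * f (?Z ls \<inter> Q) + ga * f (?Z ls \<union> Q) - (be + ga) * f (?Z ls)))"
  proof (rule expect_mono[OF fX])
    fix ls
    let ?z = "?Z ls"
    let ?G = "expect (?R (h k)) (\<lambda>g. expect (?R (k - h k)) (\<lambda>g'. f (greedy N (greedy (N - ?z) {} g) g')))"
    have "?z \<subseteq> N" using local_search_feasible[of "{}" ls] by simp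
    then have "p * (al * opt - be * f (?z \<inter> Q) - ga * f (?z \<union> Q) - e * opt) \<le> p * ?G"
      unfolding al_def be_def ga_def using Q h p by (intro mult_left_mono guided_greedy_expect) auto
    moreover have one_p: "1 - p = p * (be + ga)" using p(3) by (simp add: algebra_simps)
    ultimately show "p * (al - e) * opt - p * (be * f (?z \<inter> Q) + ga * f (?z \<union> Q) - (be + ga) * f ?z)
      \<le> p * ?G + (1 - p) * f ?z"
      unfolding one_p by (simp add: algebra_simps)
  qed
  finally have E: "expect ?X (\<lambda>ls. p * (al - e) * opt
      - p * (be * f (?Z ls \<inter> Q) + ga * f (?Z ls \<union> Q) - (be + ga) * f (?Z ls)))
      \<le> expect (algorithm a b L h N k) (\<lambda>t. f (run t f))" .
  let ?P = "expect ?X (\<lambda>ls. be * f (?Z ls \<inter> Q) + ga * f (?Z ls \<union> Q) - (be + ga) * f (?Z ls))"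
  have "p * ?P \<le> p * (2 / L * opt)"
    using local_search_expect[OF Q(1,2) c(4,3,2) assms(1)] p by (intro mult_left_mono) auto
  also have "\<dots> \<le> 2 / L * opt" using p opt_nonneg by (intro mult_left_le_one_le) auto
  finally have P: "p * ?P \<le> 2 / L * opt" .
  \<comment> \<open>Normalization by \<open>p\<close> turns the assumed ratio into
    \<open>r \<le> p * al\<close>.\<close>
  have "r = r * (p * (1 + be + ga))" unfolding p(3) by simp
  also have "\<dots> = p * (r * (1 + be + ga))" by (rule mult.left_commute)
  also have "\<dots> \<le> p * al" using ratio p unfolding al_def be_def ga_def by (intro mult_left_mono) auto
  finally have "r \<le> p * al" .
  moreover have "p * e \<le> e" using p e by (intro mult_left_le_one_le) auto
  ultimately have "(r - e) * opt \<le> (p * al - p * e) * opt" using opt_nonneg by (intro mult_right_mono) auto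
  moreover have "expect ?X (\<lambda>ls. p * (al - e) * opt
      - p * (be * f (?Z ls \<inter> Q) + ga * f (?Z ls \<union> Q) - (be + ga) * f (?Z ls))) = p * (al - e) * opt - p * ?P"
    by (subst expect_diff[OF fX]) simp
  ultimately show ?thesis using E P by (simp add: algebra_simps)
qed

end

theorem mainTheorem1:
  shows "\<exists>(C::real) (A :: 'a set \<Rightarrow> nat \<Rightarrow> 'a qtree pmf).
    \<forall>N k f. finite N \<and> k > 0 \<and> nonneg_on N f \<and> submodular_on N f \<longrightarrow>
      (\<forall>t \<in> set_pmf (A N k).
          run t f \<subseteq> N \<and> card (run t f) \<le> k \<and>
          real (num_queries t f) \<le> C * (real (card N) + real k ^ 2)) \<and>
      measure_pmf.expectation (A N k) (\<lambda>t. f (run t f)) \<ge> 385 / 1000 * opt_value N k f"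
proof -
  \<comment> \<open>The slack \<open>963/2500 - 385/1000 = 2/10000\<close> is split evenly between
    the sampling loss \<open>e\<close> and the local search loss \<open>2 / L\<close>. Then
    \<open>a\<close> and \<open>b\<close> depend only on \<open>e\<close>, so the query constant is
    universal.\<close>
  define L :: nat where "L = 20000"
  define e :: real where "e = 1 / 10000"
  obtain a b where rate: "sampling_rate a b e"
    using sampling_rate_exists[of e] by (auto simp: e_def)
  obtain h where h: "\<And>k::nat. k > 0 \<Longrightarrow> h k < k \<and> 2 * h k \<le> k \<and>
      963/2500 * (1 + greedy_inter_coeff k (h k) + greedy_union_coeff k (h k)) \<le> greedy_opt_coeff k (h k)"
    using good_switching_time by metis
  show ?thesis
  proof (intro exI[of _ "real ((L + 1) * (2 * a + 2))"] exI[of _ "algorithm a b L h"] allI impI)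
    fix N :: "'a set" and k :: nat and f :: "'a set \<Rightarrow> real"
    assume asm: "finite N \<and> k > 0 \<and> nonneg_on N f \<and> submodular_on N f"
    then interpret submodular_instance N k f a b e
      using rate by unfold_locales (auto simp: e_def)
    note hk = h[OF k_pos]
    have L: "L > 0" by (simp add: L_def)
    have "(963/2500 - e - 2 / L) * opt_value N k f \<le> expect (algorithm a b L h N k) (\<lambda>t. f (run t f))"
      using hk L by (intro algorithm_expect) auto
    moreover have "963/2500 - e - 2 / L = 385 / 1000" by (simp add: e_def L_def)
    ultimately show "(\<forall>t \<in> set_pmf (algorithm a b L h N k).
          run t f \<subseteq> N \<and> card (run t f) \<le> k \<and>
          real (num_queries t f) \<le> real ((L + 1) * (2 * a + 2)) * (real (card N) + real k ^ 2)) \<and>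
      expect (algorithm a b L h N k) (\<lambda>t. f (run t f)) \<ge> 385 / 1000 * opt_value N k f"
      using algorithm_support[of L h] hk L by auto
  qed
qed

end
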